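(* Let $X\subset P^4$ be a hypersurface with degenerate Gauss map of rank two, with a double focus $A_1$ on each rectilinear generator $L=A_0\wedge A_1$ (and $C\ne0$), described in adapted frames. If $\omega_1^0\wedge\omega_0^3=0$, then the double focus $A_1$ of the generator $A_0\wedge A_1$ describes a focal curve $G^1$, and $X$ is a twisted cone. In the space $P^4$ twisted cones exist, and the general solution of the system defining them depends on five functions of one variable.
   Context: All considerations are local. A smooth $n$-dimensional variety $X\subset P^N$ has a degenerate Gauss map of rank $r$ if its Gauss map $x\mapsto T_x(X)$ (tangent projective $n$-plane) has constant rank $r<n$ at regular points. It is foliated by leaves $L$ of dimension $n-r$, along which the tangent space $T_L$ is constant; the leaves are projective subspaces (singular points are included in $L$). Here $X\subset P^4$ is a hypersurface, $n=3$, $r=2$, so the leaves $L$ are straight lines (rectilinear generators), forming a two-parameter family. Moving frames. Take projective frames $\{A_0,\dots,A_4\}$ with $dA_u=\omega_u^vA_v$, $d\omega_u^v=\omega_u^w\wedge\omega_w^v$, where $A_0$ is a regular point of $L$, $A_1\in L$, $A_2,A_3\in T_L$, $A_4\notin T_L$, so that $L=A_0\wedge A_1$. Then $\omega_0^4=\omega_1^4=0$. The forms $\omega_0^2,\omega_0^3$ are the basis forms (linearly independent; they vanish exactly along the leaves), and for $p,q\in\{2,3\}$ $$\omega_p^4=b_{pq}\omega_0^q,\qquad \omega_1^p=c_q^p\omega_0^q,$$ with $B=(b_{pq})$ symmetric and nondegenerate, $C=(c^p_q)$, and $BC$ symmetric. The foci of $L$ are the points $x^0A_0+x^1A_1$ with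 $\det(\delta^p_qx^0+c^p_qx^1)=0$. We assume that every $L$ has a single focus, which is double; $A_1$ is placed at this focus, so that $C$ is nilpotent, and it is assumed that $C\neq0$. In a suitable frame the equations become $$\omega_2^4=b_{23}\omega_0^3,\quad \omega_3^4=b_{23}\omega_0^2+b_{33}\omega_0^3,\quad \omega_1^2=c_3^2\omega_0^3,\quad \omega_1^3=0,\qquad b_{23}\ne0,\ c_3^2\neq0. \quad ( * )$$ These are the adapted frames. The focus $A_1$ has $dA_1=\omega_1^0A_0+\omega_1^1A_1+\omega_1^2A_2$. Twisted cone in $P^4$: a hypersurface $X\subset P^4$ with degenerate Gauss map of rank two, having on each rectilinear generator $L$ a single focus $A_1$, which is double, with $C\neq0$, and whose double focus $A_1$ describes a curve $G^1$, so that $X$ foliates into a one-parameter family of two-dimensional cones (fiber cones), where the fiber cone with vertex $A_1\in G^1$ is the two-dimensional cone swept out by the generators $L$ whose focus is the fixed point $A_1$ (obtained for $\omega_1^2=0$, i.e. $\omega_0^3=0$). The system defining twisted cones is the Pfaffian system consisting of $\omega_0^4=\omega_1^4=0$, $( * )$, $\omega_1^0=a\,\omega_0^3$, and the consequence $\omega_2^3=b\,\omega_0^3$ of these equations, with unknown functions $b_{23},b_{33},c_3^2,a,b$ and independence condition $\omega_0^2\wedge\omega_0^3\neq0$. Convention (Cartan's test). Let $q$ be the number of independent 1-forms, other than the two basis forms, occurring in the exterior quadratic equations obtained by exterior differentiation of the system; let $s_1$ be the first Cartan character (here the number of independent quadratic equations) and $s_2=q-s_1$. The system is in involution if the dimension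 $S$ of the space of two-dimensional integral elements over a point equals $Q=s_1+2s_2$. "The general solution depends on $k$ functions of $p$ variables" means that the system is in involution, so that solutions exist by the Cartan–Kähler theorem, and its last nonzero character is $s_p=k$. *)

theory Defs
  imports "HOL-Analysis.Analysis"
begin

section \<open>Smooth maps and differential forms on open sets\<close>

primrec Ck_on :: "nat \<Rightarrow> ('a::euclidean_space \<Rightarrow> 'b::euclidean_space) \<Rightarrow> 'a set \<Rightarrow> bool" where
  "Ck_on 0 f S \<longleftrightarrow> continuous_on S f"
| "Ck_on (Suc k) f S \<longleftrightarrow>
     f differentiable_on S \<and> (\<forall>v. Ck_on k (\<lambda>x. frechet_derivative f (at x) v) S)"

text \<open>Only used for open \<open>S\<close>.\<close>
definition smooth_on :: "('a::euclidean_space \<Rightarrow> 'b::euclidean_space) \<Rightarrow> 'a set \<Rightarrow> bool" where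
  "smooth_on f S \<longleftrightarrow> (\<forall>k. Ck_on k f S)"

text \<open>A (vector-valued) 1-form assigns to a point a linear function of the tangent vector.\<close>
type_synonym ('a, 'b) one_form = "'a \<Rightarrow> 'a \<Rightarrow> 'b"

text \<open>The normalisations of \<open>wedge\<close> and \<open>ext_d\<close> agree, so that
  \<open>d (f dg) = df \<and> dg\<close>, without a factor 1/2.\<close>
definition wedge :: "('a \<Rightarrow> real) \<Rightarrow> ('a \<Rightarrow> real) \<Rightarrow> 'a \<Rightarrow> 'a \<Rightarrow> real" where
  "wedge \<alpha> \<beta> u v = \<alpha> u * \<beta> v - \<alpha> v * \<beta> u"

definition ext_d ::
  "('a::euclidean_space, 'b::euclidean_space) one_form \<Rightarrow> 'a \<Rightarrow> 'a \<Rightarrow> 'a \<Rightarrow> 'b" where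
  "ext_d \<theta> x u v =
     frechet_derivative (\<lambda>y. \<theta> y v) (at x) u - frechet_derivative (\<lambda>y. \<theta> y u) (at x) v"

section \<open>Hypersurfaces of real projective 4-space\<close>

text \<open>Points of \<open>P^4\<close> are given by homogeneous coordinates in \<open>real^5\<close>, a projective
  subspace by the linear subspace over it; thus \<open>span {p}\<close> is the projective point of \<open>p\<close>.
  The indices \<open>0,\<dots>,4\<close> are the elements of the numeral type \<open>5\<close>.

  \<open>proj_tangent f x\<close> is the linear subspace over the projective tangent space at \<open>x\<close> of the map
  into projective space with homogeneous coordinates \<open>f\<close>. If \<open>f x \<noteq> 0\<close>, the rank of this
  projective map at \<open>x\<close> is \<open>dim (proj_tangent f x) - 1\<close>.\<close>
definition proj_tangent ::
  "('a::euclidean_space \<Rightarrow> 'b::euclidean_space) \<Rightarrow> 'a \<Rightarrow> 'b set" where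
  "proj_tangent f x = span (insert (f x) (range (frechet_derivative f (at x))))"

text \<open>A hypersurface is given locally by a regular injective parametrization
  \<open>f\<close> over an open set \<open>U\<close>; the condition on \<open>dim\<close> forces \<open>f x \<noteq> 0\<close>.\<close>
definition hypersurface :: "(real^3 \<Rightarrow> real^5) \<Rightarrow> (real^3) set \<Rightarrow> bool" where
  "hypersurface f U \<longleftrightarrow> open U \<and> U \<noteq> {} \<and> smooth_on f U \<and>
     (\<forall>x\<in>U. dim (proj_tangent f x) = 4) \<and> inj_on (\<lambda>x. span {f x}) U"

text \<open>\<open>\<nu>\<close> is a vector of homogeneous coordinates, in the dual projective space, of the
  Gauss map \<open>x \<mapsto> T_x(X)\<close>. Such a \<open>\<nu>\<close> is unique up to a nonvanishing smooth factor, which does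
  not affect the rank.\<close>
definition has_gauss_rank :: "(real^3 \<Rightarrow> real^5) \<Rightarrow> (real^3) set \<Rightarrow> nat \<Rightarrow> bool" where
  "has_gauss_rank f U r \<longleftrightarrow> (\<exists>\<nu> :: real^3 \<Rightarrow> real^5. smooth_on \<nu> U \<and>
     (\<forall>x\<in>U. \<nu> x \<noteq> 0 \<and> (\<forall>w \<in> proj_tangent f x. \<nu> x \<bullet> w = 0) \<and>
            dim (proj_tangent \<nu> x) = r + 1))"

text \<open>The straight line \<open>l\<close> is the leaf through \<open>f x\<close>: near \<open>x\<close>, the points of the
  hypersurface on \<open>l\<close> are exactly those having the same tangent hyperplane as \<open>x\<close>.\<close>
definition generator :: "(real^3 \<Rightarrow> real^5) \<Rightarrow> (real^3) set \<Rightarrow> real^3 \<Rightarrow> (real^5) set \<Rightarrow> bool" where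
  "generator f U x l \<longleftrightarrow> subspace l \<and> dim l = 2 \<and>
     (\<exists>V. open V \<and> x \<in> V \<and> V \<subseteq> U \<and>
        {y\<in>V. proj_tangent f y = proj_tangent f x} = {y\<in>V. f y \<in> l})"

section \<open>Moving frames\<close>

text \<open>Row \<open>u\<close> of the matrix \<open>A x\<close> is the frame vector \<open>A_u\<close>, and \<open>frame_form A u v\<close> is the form
  \<open>\<omega>_u^v\<close> determined by \<open>dA_u = \<omega>_u^v A_v\<close>, that is, by \<open>dA = \<omega> A\<close>.\<close>
definition frame_form ::
  "('a::euclidean_space \<Rightarrow> real^5^5) \<Rightarrow> 5 \<Rightarrow> 5 \<Rightarrow> ('a, real) one_form" where
  "frame_form A u v x w = (frechet_derivative A (at x) w ** matrix_inv (A x)) $ u $ v"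

definition frame_field ::
  "(real^3 \<Rightarrow> real^5) \<Rightarrow> (real^3) set \<Rightarrow> (real^3 \<Rightarrow> real^5^5) \<Rightarrow> bool" where
  "frame_field f U A \<longleftrightarrow> smooth_on A U \<and>
     (\<forall>x\<in>U. invertible (A x) \<and>
        span {A x $ 0} = span {f x} \<and>
        generator f U x (span {A x $ 0, A x $ 1}) \<and>
        A x $ 2 \<in> proj_tangent f x \<and> A x $ 3 \<in> proj_tangent f x \<and>
        A x $ 4 \<notin> proj_tangent f x)"

text \<open>The matrices \<open>B\<close> and \<open>C\<close> have rows and columns numbered 2 and 3 in the frame; these
  correspond to the elements 1 and 2 of the numeral type \<open>2\<close>.\<close>
definition pidx :: "2 \<Rightarrow> 5" where
  "pidx p = (if p = 1 then 2 else 3)"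

definition frame_coeffs ::
  "(real^3) set \<Rightarrow> (real^3 \<Rightarrow> real^5^5) \<Rightarrow> (real^3 \<Rightarrow> real^2^2) \<Rightarrow> (real^3 \<Rightarrow> real^2^2) \<Rightarrow> bool" where
  "frame_coeffs U A B C \<longleftrightarrow> (\<forall>x\<in>U.
     transpose (B x) = B x \<and> invertible (B x) \<and> transpose (B x ** C x) = B x ** C x \<and>
     (\<forall>w. frame_form A 0 4 x w = 0 \<and> frame_form A 1 4 x w = 0 \<and>
        (\<forall>p. frame_form A (pidx p) 4 x w = (\<Sum>q\<in>UNIV. B x $ p $ q * frame_form A 0 (pidx q) x w)) \<and>
        (\<forall>p. frame_form A 1 (pidx p) x w = (\<Sum>q\<in>UNIV. C x $ p $ q * frame_form A 0 (pidx q) x w))))"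

text \<open>The foci of \<open>L\<close> are the points \<open>x0 A_0 + x1 A_1\<close> at which this binary quadratic form
  vanishes.\<close>
definition focal_form :: "real^2^2 \<Rightarrow> real \<Rightarrow> real \<Rightarrow> real" where
  "focal_form C x0 x1 = det (mat x0 + x1 *\<^sub>R C)"

text \<open>The point \<open>(s0 : s1)\<close> of \<open>L\<close> is its only focus, and this focus is double.\<close>
definition double_focus :: "real^2^2 \<Rightarrow> real \<Rightarrow> real \<Rightarrow> bool" where
  "double_focus C s0 s1 \<longleftrightarrow> (s0, s1) \<noteq> (0, 0) \<and>
     (\<exists>k. k \<noteq> 0 \<and> (\<forall>x0 x1. focal_form C x0 x1 = k * (s1 * x0 - s0 * x1)\<^sup>2))"

definition double_focus_frame ::
  "(real^3 \<Rightarrow> real^5) \<Rightarrow> (real^3) set \<Rightarrow> (real^3 \<Rightarrow> real^5^5) \<Rightarrow> bool" where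
  "double_focus_frame f U A \<longleftrightarrow> frame_field f U A \<and>
     (\<exists>B C. frame_coeffs U A B C \<and> (\<forall>x\<in>U. double_focus (C x) 0 1 \<and> C x \<noteq> 0))"

definition adapted_frame ::
  "(real^3 \<Rightarrow> real^5) \<Rightarrow> (real^3) set \<Rightarrow> (real^3 \<Rightarrow> real^5^5) \<Rightarrow> bool" where
  "adapted_frame f U A \<longleftrightarrow> double_focus_frame f U A \<and>
     (\<exists>b23 b33 c32 :: real^3 \<Rightarrow> real. \<forall>x\<in>U. b23 x \<noteq> 0 \<and> c32 x \<noteq> 0 \<and>
        (\<forall>w. let \<omega> = (\<lambda>u v. frame_form A u v x w) in
           \<omega> 2 4 = b23 x * \<omega> 0 3 \<and>
           \<omega> 3 4 = b23 x * \<omega> 0 2 + b33 x * \<omega> 0 3 \<and>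
           \<omega> 1 2 = c32 x * \<omega> 0 3 \<and>
           \<omega> 1 3 = 0))"

section \<open>Twisted cones\<close>

definition regular_curve :: "(real \<Rightarrow> real^5) \<Rightarrow> real set \<Rightarrow> bool" where
  "regular_curve g I \<longleftrightarrow> open I \<and> connected I \<and> I \<noteq> {} \<and> smooth_on g I \<and>
     (\<forall>t\<in>I. dim (proj_tangent g t) = 2) \<and> inj_on (\<lambda>t. span {g t}) I"

definition traces_curve ::
  "(real^3 \<Rightarrow> real^5) \<Rightarrow> (real^3) set \<Rightarrow> (real \<Rightarrow> real^5) \<Rightarrow> real set \<Rightarrow> bool" where
  "traces_curve F V g I \<longleftrightarrow> regular_curve g I \<and>
     (\<lambda>y. span {F y}) ` V = (\<lambda>t. span {g t}) ` I"

text \<open>Local statement: near each parameter value the points \<open>[F y]\<close> fill a regular curve.\<close>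
definition describes_curve :: "(real^3 \<Rightarrow> real^5) \<Rightarrow> (real^3) set \<Rightarrow> bool" where
  "describes_curve F U \<longleftrightarrow>
     (\<forall>x\<in>U. \<exists>V g I. open V \<and> x \<in> V \<and> V \<subseteq> U \<and> traces_curve F V g I)"

text \<open>The parameter values whose generator has its focus \<open>[F y]\<close> at the point \<open>[p]\<close>.\<close>
definition fiber_cone :: "(real^3 \<Rightarrow> real^5) \<Rightarrow> (real^3) set \<Rightarrow> real^5 \<Rightarrow> (real^3) set" where
  "fiber_cone F V p = {y\<in>V. span {F y} = span {p}}"

text \<open>The fiber cones are the level surfaces of a submersion onto the curve parameter, hence
  they form a one-parameter family of surfaces foliating \<open>V\<close>; and each of them
  consists of (pieces of) generators, all of which pass through its vertex \<open>[g t]\<close>.\<close>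
definition foliates_into_cones ::
  "(real^3 \<Rightarrow> real^5) \<Rightarrow> (real^3 \<Rightarrow> real^5^5) \<Rightarrow> (real^3) set \<Rightarrow> (real \<Rightarrow> real^5) \<Rightarrow> real set \<Rightarrow> bool" where
  "foliates_into_cones f A V g I \<longleftrightarrow>
     (\<exists>\<tau> :: real^3 \<Rightarrow> real. smooth_on \<tau> V \<and> \<tau> ` V = I \<and>
        (\<forall>y\<in>V. \<exists>w. frechet_derivative \<tau> (at y) w \<noteq> 0) \<and>
        (\<forall>t\<in>I. fiber_cone (\<lambda>x. A x $ 1) V (g t) = {y\<in>V. \<tau> y = t})) \<and>
     (\<forall>t\<in>I. \<forall>y \<in> fiber_cone (\<lambda>x. A x $ 1) V (g t).
        g t \<in> span {A y $ 0, A y $ 1} \<and>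
        (\<exists>W. open W \<and> y \<in> W \<and> W \<subseteq> V \<and>
           {z\<in>W. f z \<in> span {A y $ 0, A y $ 1}} \<subseteq> fiber_cone (\<lambda>x. A x $ 1) V (g t)))"

definition twisted_cone :: "(real^3 \<Rightarrow> real^5) \<Rightarrow> (real^3) set \<Rightarrow> bool" where
  "twisted_cone f U \<longleftrightarrow> hypersurface f U \<and> has_gauss_rank f U 2 \<and>
     (\<exists>A. double_focus_frame f U A \<and>
        (\<forall>x\<in>U. \<exists>V g I. open V \<and> x \<in> V \<and> V \<subseteq> U \<and>
           traces_curve (\<lambda>y. A y $ 1) V g I \<and> foliates_into_cones f A V g I))"

section \<open>Cartan's test for Pfaffian systems with two independent variables\<close>

text \<open>A Pfaffian system is given by a vector-valued 1-form \<open>\<theta>\<close> (its components are the equations)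
  and by the pair \<open>\<eta>\<close> of basis forms. All quantities are taken at a point \<open>p\<close>; the quadratic
  equations \<open>d\<theta> = 0\<close> are considered modulo \<open>\<theta>\<close>, that is, on \<open>integral_vectors \<theta> p\<close>.\<close>
definition integral_vectors ::
  "('a::euclidean_space, 'b::euclidean_space) one_form \<Rightarrow> 'a \<Rightarrow> 'a set" where
  "integral_vectors \<theta> p = {w. \<theta> p w = 0}"

text \<open>The common kernel of the basis forms and of all 1-forms \<open>d\<theta>(v, -)\<close>; the latter span the
  1-forms that occur in the quadratic equations.\<close>
definition characteristic_vectors ::
  "('a::euclidean_space, 'b::euclidean_space) one_form \<Rightarrow> ('a, real \<times> real) one_form \<Rightarrow> 'a \<Rightarrow> 'a set" where
  "characteristic_vectors \<theta> \<eta> p =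
     {w \<in> integral_vectors \<theta> p. \<eta> p w = 0 \<and> (\<forall>v \<in> integral_vectors \<theta> p. ext_d \<theta> p v w = 0)}"

text \<open>The number \<open>q\<close>: the codimension of the common kernel counts the independent forms, and the
  two basis forms are left out.\<close>
definition occurring_forms ::
  "('a::euclidean_space, 'b::euclidean_space) one_form \<Rightarrow> ('a, real \<times> real) one_form \<Rightarrow> 'a \<Rightarrow> int" where
  "occurring_forms \<theta> \<eta> p =
     int (dim (integral_vectors \<theta> p)) - int (dim (characteristic_vectors \<theta> \<eta> p)) - 2"

text \<open>The number of linearly independent components of \<open>d\<theta>\<close> modulo \<open>\<theta>\<close>, as the dimension of the
  span of its values.\<close>
definition quadratic_equations ::
  "('a::euclidean_space, 'b::euclidean_space) one_form \<Rightarrow> 'a \<Rightarrow> nat" where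
  "quadratic_equations \<theta> p =
     dim {ext_d \<theta> p u v | u v. u \<in> integral_vectors \<theta> p \<and> v \<in> integral_vectors \<theta> p}"

text \<open>The first Cartan character: the maximal rank, modulo the basis forms, of the polar equations
  \<open>d\<theta>(v, -) = 0\<close> of a one-dimensional integral element.\<close>
definition first_character ::
  "('a::euclidean_space, 'b::euclidean_space) one_form \<Rightarrow> ('a, real \<times> real) one_form \<Rightarrow> 'a \<Rightarrow> nat" where
  "first_character \<theta> \<eta> p =
     Max ((\<lambda>v. dim (ext_d \<theta> p v ` {w \<in> integral_vectors \<theta> p. \<eta> p w = 0})) ` integral_vectors \<theta> p)"

definition cartan_character ::
  "('a::euclidean_space, 'b::euclidean_space) one_form \<Rightarrow> ('a, real \<times> real) one_form \<Rightarrow> 'a \<Rightarrow> nat \<Rightarrow> int" where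
  "cartan_character \<theta> \<eta> p i =
     (if i = 1 then int (first_character \<theta> \<eta> p)
      else if i = 2 then occurring_forms \<theta> \<eta> p - int (first_character \<theta> \<eta> p)
      else 0)"

text \<open>A two-dimensional integral element on which the basis forms are independent is represented by
  its basis dual to \<open>\<eta>\<close>.\<close>
definition integral_elements ::
  "('a::euclidean_space, 'b::euclidean_space) one_form \<Rightarrow> ('a, real \<times> real) one_form \<Rightarrow> 'a \<Rightarrow> ('a \<times> 'a) set" where
  "integral_elements \<theta> \<eta> p =
     {(u, v). u \<in> integral_vectors \<theta> p \<and> v \<in> integral_vectors \<theta> p \<and>
        \<eta> p u = (1, 0) \<and> \<eta> p v = (0, 1) \<and> ext_d \<theta> p u v = 0}"

text \<open>The number \<open>S\<close>. Only the values of the forms that occur in the quadratic equations count, so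
  the integral elements are taken modulo \<open>characteristic_vectors\<close> (in each of the two
  basis vectors): otherwise the directions of the frame bundle that do not affect the
  equations would be counted too.\<close>
definition integral_elements_dim ::
  "('a::euclidean_space, 'b::euclidean_space) one_form \<Rightarrow> ('a, real \<times> real) one_form \<Rightarrow> 'a \<Rightarrow> int" where
  "integral_elements_dim \<theta> \<eta> p =
     aff_dim (integral_elements \<theta> \<eta> p) - 2 * int (dim (characteristic_vectors \<theta> \<eta> p))"

text \<open>The requirement that the integral elements form an affine space makes \<open>aff_dim\<close> their
  dimension.\<close>
definition in_involution ::
  "('a::euclidean_space, 'b::euclidean_space) one_form \<Rightarrow> ('a, real \<times> real) one_form \<Rightarrow> 'a \<Rightarrow> bool" where
  "in_involution \<theta> \<eta> p \<longleftrightarrow> affine (integral_elements \<theta> \<eta> p) \<and>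
     integral_elements_dim \<theta> \<eta> p = cartan_character \<theta> \<eta> p 1 + 2 * cartan_character \<theta> \<eta> p 2"

text \<open>``The general solution depends on \<open>k\<close> functions of \<open>r\<close> variables.''\<close>
definition general_solution_depends_on ::
  "('a::euclidean_space, 'b::euclidean_space) one_form \<Rightarrow> ('a, real \<times> real) one_form \<Rightarrow> 'a set \<Rightarrow> nat \<Rightarrow> nat \<Rightarrow> bool" where
  "general_solution_depends_on \<theta> \<eta> M k r \<longleftrightarrow> (\<forall>p\<in>M. in_involution \<theta> \<eta> p \<and>
     cartan_character \<theta> \<eta> p r = int k \<and> k \<noteq> 0 \<and> (\<forall>j>r. cartan_character \<theta> \<eta> p j = 0))"

text \<open>\<open>\<Phi>\<close> may depend on more than two parameters, since it may also move along the leaves, where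
  the basis forms vanish.\<close>
definition solves_system ::
  "('a::euclidean_space, 'b::euclidean_space) one_form \<Rightarrow> ('a, real \<times> real) one_form \<Rightarrow> 'a set \<Rightarrow>
   ('c::euclidean_space \<Rightarrow> 'a) \<Rightarrow> 'c set \<Rightarrow> bool" where
  "solves_system \<theta> \<eta> M \<Phi> U \<longleftrightarrow> open U \<and> U \<noteq> {} \<and> smooth_on \<Phi> U \<and> \<Phi> ` U \<subseteq> M \<and>
     (\<forall>x\<in>U. (\<forall>w. \<theta> (\<Phi> x) (frechet_derivative \<Phi> (at x) w) = 0) \<and>
            range (\<lambda>w. \<eta> (\<Phi> x) (frechet_derivative \<Phi> (at x) w)) = UNIV)"

section \<open>The system defining twisted cones\<close>

text \<open>The unknowns are a frame and the functions \<open>b23, b33, c32, a, b\<close>, in this order; \<open>fst\<close> is the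
  tautological frame, so \<open>frame_form fst\<close> gives the invariant forms of the frame space.\<close>
type_synonym cone_point = "(real^5^5) \<times> real \<times> real \<times> real \<times> real \<times> real"

definition cone_domain :: "cone_point set" where
  "cone_domain = {(A, b23, b33, c32, a, b). invertible A \<and> b23 \<noteq> 0 \<and> c32 \<noteq> 0}"

definition cone_system ::
  "(cone_point, real \<times> real \<times> real \<times> real \<times> real \<times> real \<times> real \<times> real) one_form" where
  "cone_system p w = (case p of (A, b23, b33, c32, a, b) \<Rightarrow>
     let \<omega> = (\<lambda>u v. frame_form fst u v p w) in
       (\<omega> 0 4,
        \<omega> 1 4,
        \<omega> 2 4 - b23 * \<omega> 0 3,
        \<omega> 3 4 - (b23 * \<omega> 0 2 + b33 * \<omega> 0 3),
        \<omega> 1 2 - c32 * \<omega> 0 3,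
        \<omega> 1 3,
        \<omega> 1 0 - a * \<omega> 0 3,
        \<omega> 2 3 - b * \<omega> 0 3))"

definition cone_basis :: "(cone_point, real \<times> real) one_form" where
  "cone_basis p w = (frame_form fst 0 2 p w, frame_form fst 0 3 p w)"

end

(*
  Write A for the adapted frame and w_u^v for its forms. If w_1^0 is a multiple of w_0^3, then
  dA_1 = w_1^1 A_1 + w_0^3 (a A_0 + c A_2), so the projective map x -> [A_1(x)] has rank one and
  its fibres are the level surfaces of one affine coordinate tau of A_1: this gives the focal
  curve and the submersion tau. The Gauss map of rank two is, transversally to the leaves, a
  submersion whose kernel is w_0^2 = w_0^3 = 0, whence tau is constant along the generators.
  Twisted cones exist: if g, g', g'', q, q' is a basis for every t, the point
  q(t) + s g'(t) + u g(t) sweeps out one, with focal curve g.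
  Modulo the system, its exterior derivatives are five quadratic equations in five further forms
  alpha_i, which with the basis forms are independent because alpha_i contains the differential
  of the i-th unknown function. Hence s_1 = q = 5, s_2 = 0, and the integral elements over a
  point are parametrised by five numbers.
*)
theory Submission
  imports Defs
begin

section \<open>Smooth maps\<close>

text \<open>Two obstacles shape the geometric half. Smoothness of infinite order is demanded, while
  the coordinate change obtained from the inverse function theorem is used only as a once
  differentiable map; smoothness of the focal curve is recovered by following a straight transversal
  in these coordinates, whose image solves an autonomous equation with smooth right-hand side. And a
  generator enters as a set of points with a common tangent hyperplane, without a path inside the
  chart joining two of them; equality of the values of the Gauss map replaces such a path.
  Homogeneous coordinates of the focus are made unique by setting one of them equal to 1. In the
  computation with the Pfaffian system the point is to absorb all terms into five forms. This works
  because d\<omega>_0^3 is itself a multiple of \<omega>_0^3 modulo the system; only the equation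
  for \<omega>_3^4 also involves \<omega>_0^2, and there the form of the equation for \<omega>_2^4
  returns, so that no sixth form appears.\<close>

lemma Ck_on_cong:
  fixes f g :: "'a::euclidean_space \<Rightarrow> 'b::euclidean_space"
  assumes "open S" "Ck_on k f S" "\<And>x. x \<in> S \<Longrightarrow> f x = g x"
  shows "Ck_on k g S"
  using assms(2,3)
proof (induction k arbitrary: f g)
  case 0
  then show ?case by (simp cong: continuous_on_cong)
next
  case (Suc k)
  have df: "f differentiable at x" if "x \<in> S" for x
    using Suc.prems(1) that assms(1) by (simp add: differentiable_on_eq_differentiable_at)
  have "frechet_derivative f (at x) = frechet_derivative g (at x)" if "x \<in> S" for x
    using frechet_derivative_transform_within_open[OF df assms(1)] that Suc.prems(2) by blast
  then have "Ck_on k (\<lambda>x. frechet_derivative g (at x) v) S" for v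
    using Suc.IH[of "\<lambda>x. frechet_derivative f (at x) v"] Suc.prems(1) by simp
  moreover have "g differentiable_on S"
    using Suc.prems by (auto simp: differentiable_on_def intro: differentiable_transform_within[OF _ zero_less_one])
  ultimately show ?case by simp
qed

text \<open>The recursion is phrased with \<open>frechet_derivative\<close>; this rule accepts any
  explicit derivative, so each closure property reduces to the shape of its differentiation
  formula.\<close>

lemma Ck_on_SucI:
  assumes "open S" and d: "\<And>x. x \<in> S \<Longrightarrow> (f has_derivative f' x) (at x)"
    and C: "\<And>v. Ck_on k (\<lambda>x. f' x v) S"
  shows "Ck_on (Suc k) f S"
proof -
  have "f differentiable_on S"
    using d by (meson differentiable_at_withinI differentiable_def differentiable_on_def)
  moreover have "Ck_on k (\<lambda>x. frechet_derivative f (at x) v) S" for v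
    by (rule Ck_on_cong[OF assms(1) C]) (simp add: frechet_derivative_at[OF d, symmetric])
  ultimately show ?thesis by simp
qed

lemma Ck_on_has_derivative:
  assumes "open S" "Ck_on (Suc k) f S" "x \<in> S"
  shows "(f has_derivative frechet_derivative f (at x)) (at x)"
  using assms by (simp add: differentiable_on_eq_differentiable_at flip: frechet_derivative_works)

lemma Ck_on_SucD: "open S \<Longrightarrow> Ck_on (Suc k) f S \<Longrightarrow> Ck_on k f S"
  by (induction k arbitrary: f) (auto simp: differentiable_imp_continuous_on)

lemma Ck_on_subset: "Ck_on k f S \<Longrightarrow> T \<subseteq> S \<Longrightarrow> Ck_on k f T"
  by (induction k arbitrary: f) (auto intro: continuous_on_subset differentiable_on_subset)

lemma Ck_on_const: "open S \<Longrightarrow> Ck_on k (\<lambda>x. c) S"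
  by (induction k arbitrary: c) (auto intro: Ck_on_SucI)

lemma Ck_on_linear:
  assumes "open S" "bounded_linear L" "Ck_on k f S"
  shows "Ck_on k (\<lambda>x. L (f x)) S"
  using assms(3)
proof (induction k arbitrary: f)
  case 0
  then show ?case using assms(2) by (simp add: bounded_linear.continuous_on)
next
  case (Suc k)
  show ?case
  proof (rule Ck_on_SucI[OF _ bounded_linear.has_derivative[OF assms(2) Ck_on_has_derivative[OF _ Suc.prems]]])
    show "Ck_on k (\<lambda>x. L (frechet_derivative f (at x) v)) S" for v
      using Suc by simp
  qed (use assms(1) in auto)
qed

lemma Ck_on_add:
  assumes "open S" "Ck_on k f S" "Ck_on k g S"
  shows "Ck_on k (\<lambda>x. f x + g x) S"
  using assms(2,3)
proof (induction k arbitrary: f g)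
  case 0
  then show ?case by (simp add: continuous_on_add)
next
  case (Suc k)
  show ?case
  proof (rule Ck_on_SucI[OF _ has_derivative_add[OF Ck_on_has_derivative[OF _ Suc.prems(1)] Ck_on_has_derivative[OF _ Suc.prems(2)]]])
    show "Ck_on k (\<lambda>x. frechet_derivative f (at x) v + frechet_derivative g (at x) v) S" for v
      using Suc by simp
  qed (use assms(1) in auto)
qed

lemma Ck_on_bilinear:
  assumes "open S" "bounded_bilinear P" "Ck_on k f S" "Ck_on k g S"
  shows "Ck_on k (\<lambda>x. P (f x) (g x)) S"
  using assms(3,4)
proof (induction k arbitrary: f g)
  case 0
  then show ?case using assms(2) by (simp add: bounded_bilinear.continuous_on)
next
  case (Suc k)
  show ?case
  proof (rule Ck_on_SucI[OF _ bounded_bilinear.FDERIV[OF assms(2) Ck_on_has_derivative[OF _ Suc.prems(1)] Ck_on_has_derivative[OF _ Suc.prems(2)]]])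
    show "Ck_on k (\<lambda>x. P (f x) (frechet_derivative g (at x) v) + P (frechet_derivative f (at x) v) (g x)) S" for v
      using Suc.prems Ck_on_SucD[OF assms(1) Suc.prems(1)] Ck_on_SucD[OF assms(1) Suc.prems(2)]
      by (intro Ck_on_add assms(1) Suc.IH) auto
  qed (use assms(1) in auto)
qed

lemma Ck_on_sum:
  assumes "open S" "\<And>i. i \<in> I \<Longrightarrow> Ck_on k (f i) S"
  shows "Ck_on k (\<lambda>x. \<Sum>i\<in>I. f i x) S"
  using assms(2) by (induction I rule: infinite_finite_induct) (auto simp: Ck_on_const Ck_on_add assms(1))

lemma Ck_on_compose:
  fixes f :: "'b::euclidean_space \<Rightarrow> 'c::euclidean_space" and g :: "'a::euclidean_space \<Rightarrow> 'b"
  assumes "open S" "open T" "Ck_on k f S" "Ck_on k g T" "g ` T \<subseteq> S"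
  shows "Ck_on k (\<lambda>x. f (g x)) T"
  using assms(3,4)
proof (induction k arbitrary: f)
  case 0
  then show ?case using continuous_on_compose2[of S f T g] assms(5) by simp
next
  case (Suc k)
  let ?f' = "\<lambda>x. frechet_derivative f (at x)" and ?g' = "\<lambda>x. frechet_derivative g (at x)"
  have g: "Ck_on k g T" using Suc.prems(2) Ck_on_SucD[OF assms(2)] by blast
  have f': "(f has_derivative ?f' y) (at y)" if "y \<in> S" for y
    using Ck_on_has_derivative[OF assms(1) Suc.prems(1) that] .
  have g': "(g has_derivative ?g' x) (at x)" if "x \<in> T" for x
    using Ck_on_has_derivative[OF assms(2) Suc.prems(2) that] .
  \<comment> \<open>The direction \<open>?g' x v\<close> moves with \<open>x\<close>, while
    \<open>Ck_on\<close> controls derivatives in fixed directions only. Expanding in the basis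
    splits the chain rule into products covered by the induction hypothesis, which holds for all
    \<open>f\<close> with \<open>g\<close> fixed.\<close>
  have d: "((\<lambda>x. f (g x)) has_derivative (\<lambda>v. \<Sum>b\<in>Basis. (?g' x v \<bullet> b) *\<^sub>R ?f' (g x) b)) (at x)"
    if "x \<in> T" for x
  proof -
    have fg: "(f has_derivative ?f' (g x)) (at (g x))" using f' that assms(5) by blast
    have lin: "linear (?f' (g x))" using fg has_derivative_linear by blast
    have "?f' (g x) (?g' x v) = (\<Sum>b\<in>Basis. (?g' x v \<bullet> b) *\<^sub>R ?f' (g x) b)" for v
      by (subst (1) euclidean_representation[symmetric, of "?g' x v"])
         (simp only: linear_sum[OF lin] linear_scale[OF lin])
    then show ?thesis using has_derivative_compose[OF g'[OF that] fg] by simp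
  qed
  show ?case
  proof (rule Ck_on_SucI[OF assms(2) d])
    fix v
    show "Ck_on k (\<lambda>x. \<Sum>b\<in>Basis. (?g' x v \<bullet> b) *\<^sub>R ?f' (g x) b) T"
    proof (intro Ck_on_sum assms(2) Ck_on_bilinear[OF _ bounded_bilinear_scaleR])
      fix b :: 'b
      show "Ck_on k (\<lambda>x. ?g' x v \<bullet> b) T"
        using Suc.prems(2) by (intro Ck_on_linear[OF assms(2) bounded_linear_inner_left]) auto
      show "Ck_on k (\<lambda>x. ?f' (g x) b) T"
        using Suc.IH[OF _ g] Suc.prems(1) by auto
    qed
  qed
qed

lemma Ck_on_componentwise:
  fixes f :: "'a::euclidean_space \<Rightarrow> 'b::euclidean_space"
  assumes "open S" "\<And>b. b \<in> Basis \<Longrightarrow> Ck_on k (\<lambda>x. f x \<bullet> b) S"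
  shows "Ck_on k f S"
proof -
  have "Ck_on k (\<lambda>x. \<Sum>b\<in>Basis. (f x \<bullet> b) *\<^sub>R b) S"
    using assms by (intro Ck_on_sum Ck_on_linear[OF _ bounded_linear_scaleR_left])
  then show ?thesis by (simp add: euclidean_representation)
qed

text \<open>The derivative of the reciprocal is built from two copies of it, so each order of
  smoothness yields the next.\<close>

lemma Ck_on_inverse: "Ck_on k (inverse :: real \<Rightarrow> real) (- {0})"
proof (induction k)
  case 0
  then show ?case by (auto intro!: continuous_intros)
next
  case (Suc k)
  have o: "open (- {0::real})" by auto
  show ?case
  proof (rule Ck_on_SucI[OF o])
    show "(inverse has_derivative (\<lambda>v. - (inverse x * v * inverse x))) (at x)" if "x \<in> - {0}" for x :: real
      using that by (auto intro: has_derivative_inverse')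
    have "Ck_on k (\<lambda>x::real. (- v) *\<^sub>R (inverse x * inverse x)) (- {0})" for v
      by (intro Ck_on_linear[OF o bounded_linear_scaleR_right] Ck_on_bilinear[OF o bounded_bilinear_mult] Suc)
    then show "Ck_on k (\<lambda>x::real. - (inverse x * v * inverse x)) (- {0})" for v
      by (simp add: mult_ac)
  qed
qed

section \<open>Closure properties of smooth maps\<close>

lemma smooth_on_has_derivative:
  "open S \<Longrightarrow> smooth_on f S \<Longrightarrow> x \<in> S \<Longrightarrow> (f has_derivative frechet_derivative f (at x)) (at x)"
  unfolding smooth_on_def using Ck_on_has_derivative by blast

lemma smooth_on_frechet_derivative:
  "smooth_on f S \<Longrightarrow> smooth_on (\<lambda>x. frechet_derivative f (at x) v) S"
  unfolding smooth_on_def by (metis Ck_on.simps(2))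

lemma smooth_on_imp_continuous_on: "smooth_on f S \<Longrightarrow> continuous_on S f"
  unfolding smooth_on_def by (metis Ck_on.simps(1))

lemma smooth_on_subset: "smooth_on f S \<Longrightarrow> T \<subseteq> S \<Longrightarrow> smooth_on f T"
  unfolding smooth_on_def using Ck_on_subset by blast

lemma smooth_on_const: "open S \<Longrightarrow> smooth_on (\<lambda>x. c) S"
  unfolding smooth_on_def using Ck_on_const by blast

lemma smooth_on_linear:
  "open S \<Longrightarrow> bounded_linear L \<Longrightarrow> smooth_on f S \<Longrightarrow> smooth_on (\<lambda>x. L (f x)) S"
  unfolding smooth_on_def using Ck_on_linear by blast

lemma smooth_on_id: "open S \<Longrightarrow> smooth_on (\<lambda>x. x) S"
  unfolding smooth_on_def
proof
  show "Ck_on k (\<lambda>x. x) S" if "open S" for k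
    using that by (cases k) (auto intro: Ck_on_SucI Ck_on_const)
qed

lemma smooth_on_add:
  "open S \<Longrightarrow> smooth_on f S \<Longrightarrow> smooth_on g S \<Longrightarrow> smooth_on (\<lambda>x. f x + g x) S"
  unfolding smooth_on_def using Ck_on_add by blast

lemma smooth_on_bilinear:
  "open S \<Longrightarrow> bounded_bilinear P \<Longrightarrow> smooth_on f S \<Longrightarrow> smooth_on g S \<Longrightarrow>
    smooth_on (\<lambda>x. P (f x) (g x)) S"
  unfolding smooth_on_def using Ck_on_bilinear by blast

lemma smooth_on_Pair:
  assumes "open S" "smooth_on f S" "smooth_on g S"
  shows "smooth_on (\<lambda>x. (f x, g x)) S"
proof -
  have "smooth_on (\<lambda>x. (f x, 0) + (0, g x)) S"
    using assms by (intro smooth_on_add smooth_on_linear[of S "\<lambda>a. (a, 0)" f] smooth_on_linear[of S "\<lambda>a. (0, a)" g]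
        bounded_linear_Pair bounded_linear_ident bounded_linear_zero)
  then show ?thesis by simp
qed

lemma smooth_on_compose:
  "open S \<Longrightarrow> open T \<Longrightarrow> smooth_on f S \<Longrightarrow> smooth_on g T \<Longrightarrow> g ` T \<subseteq> S \<Longrightarrow> smooth_on (\<lambda>x. f (g x)) T"
  unfolding smooth_on_def using Ck_on_compose by blast

lemma smooth_on_componentwise:
  fixes f :: "'a::euclidean_space \<Rightarrow> 'b::euclidean_space"
  shows "open S \<Longrightarrow> (\<And>b. b \<in> Basis \<Longrightarrow> smooth_on (\<lambda>x. f x \<bullet> b) S) \<Longrightarrow> smooth_on f S"
  unfolding smooth_on_def using Ck_on_componentwise by blast

lemma smooth_on_inverse:
  fixes f :: "'a::euclidean_space \<Rightarrow> real"
  assumes "open S" "smooth_on f S" "\<And>x. x \<in> S \<Longrightarrow> f x \<noteq> 0"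
  shows "smooth_on (\<lambda>x. inverse (f x)) S"
  using assms by (intro smooth_on_compose[of "- {0}" S inverse f]) (auto simp: smooth_on_def Ck_on_inverse)

text \<open>Each derivative of a solution of \<open>\<xi>' = X \<circ> \<xi>\<close> gains one order of smoothness.\<close>
lemma smooth_on_ode_solution:
  fixes \<xi> :: "real \<Rightarrow> 'a::euclidean_space"
  assumes "open J" "open S" "smooth_on X S" "\<xi> ` J \<subseteq> S"
    and d: "\<And>t. t \<in> J \<Longrightarrow> (\<xi> has_vector_derivative X (\<xi> t)) (at t)"
  shows "smooth_on \<xi> J"
  unfolding smooth_on_def
proof
  fix k
  show "Ck_on k \<xi> J"
  proof (induction k)
    case 0
    then show ?case
      using d by (auto simp: has_vector_derivative_def intro!: continuous_at_imp_continuous_on has_derivative_continuous)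
  next
    case (Suc k)
    show ?case
    proof (rule Ck_on_SucI[OF assms(1)])
      show "(\<xi> has_derivative (\<lambda>h. h *\<^sub>R X (\<xi> t))) (at t)" if "t \<in> J" for t
        using d[OF that] by (simp add: has_vector_derivative_def)
      show "Ck_on k (\<lambda>t. v *\<^sub>R X (\<xi> t)) J" for v
        using assms(3) by (intro Ck_on_linear[OF assms(1) bounded_linear_scaleR_right]
            Ck_on_compose[OF assms(2,1) _ Suc assms(4)]) (simp add: smooth_on_def)
    qed
  qed
qed

section \<open>Submersions and functional dependence\<close>

text \<open>In the coordinates \<open>z = x + R (N x - N y - L (x - y))\<close>, where \<open>R\<close> is a right inverse of the
  derivative \<open>L\<close> of \<open>N\<close> at \<open>y\<close>, the map \<open>N\<close> becomes affine.\<close>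
lemma submersion_coordinates:
  fixes N :: "'a::euclidean_space \<Rightarrow> 'b::euclidean_space" and L :: "'a \<Rightarrow> 'b"
  assumes "open U" "y \<in> U" "smooth_on N U"
    and L: "L = frechet_derivative N (at y)" and R: "linear R" "\<And>t. L (R t) = t"
  obtains r \<phi> \<phi>' where "0 < r" "\<phi> y = y"
    "\<phi> ` ball y r \<subseteq> U" "open (\<phi> ` ball y r)"
    "\<And>z. z \<in> ball y r \<Longrightarrow> (\<phi> has_derivative \<phi>' z) (at z)"
    "\<And>z v. z \<in> ball y r \<Longrightarrow>
       \<phi>' z v + R (frechet_derivative N (at (\<phi> z)) (\<phi>' z v) - L (\<phi>' z v)) = v"
    "\<And>z. z \<in> ball y r \<Longrightarrow> N (\<phi> z) = N y + L (z - y)"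
    "\<And>z v. z \<in> ball y r \<Longrightarrow> frechet_derivative N (at (\<phi> z)) (\<phi>' z v) = L v"
proof -
  let ?N' = "\<lambda>x. frechet_derivative N (at x)"
  have dN: "(N has_derivative ?N' x) (at x)" if "x \<in> U" for x
    using smooth_on_has_derivative[OF assms(1,3) that] .
  have L': "linear L" using dN[OF assms(2)] has_derivative_linear L by blast
  define \<psi> where "\<psi> x = x + R (N x - N y - L (x - y))" for x
  define \<psi>' where "\<psi>' x v = v + R (?N' x v - L v)" for x v
  have d\<psi>: "(\<psi> has_derivative \<psi>' x) (at x)" if "x \<in> U" for x
  proof -
    have "((\<lambda>x. N x - N y - L (x - y)) has_derivative (\<lambda>v. ?N' x v - 0 - L (v - 0))) (at x)"
      using dN[OF that] L' by (intro has_derivative_diff has_derivative_const has_derivative_ident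
          linear_imp_has_derivative bounded_linear.has_derivative[OF linear_conv_bounded_linear[THEN iffD1, OF L']])
    then have "((\<lambda>x. R (N x - N y - L (x - y))) has_derivative (\<lambda>v. R (?N' x v - L v))) (at x)"
      using bounded_linear.has_derivative[OF linear_conv_bounded_linear[THEN iffD1, OF R(1)]] by fastforce
    then show ?thesis
      unfolding \<psi>_def \<psi>'_def by (intro has_derivative_add has_derivative_ident)
  qed
  have bl: "bounded_linear (\<psi>' x)" if "x \<in> U" for x
    using d\<psi>[OF that] has_derivative_bounded_linear by blast
  \<comment> \<open>Since \<open>R\<close> is a right inverse of \<open>L\<close>, applying
    \<open>L\<close> cancels everything except \<open>N x - N y\<close>: in the coordinate
    \<open>\<psi> x\<close> the map \<open>N\<close> is affine.\<close>
  have L\<psi>: "L (\<psi> x - y) = N x - N y" for x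
    unfolding \<psi>_def by (simp add: linear_diff[OF L'] linear_add[OF L'] R(2))
  have L\<psi>': "L (\<psi>' x v) = ?N' x v" for x v
    unfolding \<psi>'_def by (simp add: linear_diff[OF L'] linear_add[OF L'] R(2))
  have cont: "continuous_on U (\<lambda>x. Blinfun (\<psi>' x))"
  proof (rule continuous_on_blinfun_componentwise)
    fix i :: 'a
    have "continuous_on U (\<lambda>x. i + R (?N' x i - L i))"
      using smooth_on_imp_continuous_on[OF smooth_on_frechet_derivative[OF assms(3)]]
      by (intro continuous_intros linear_continuous_on_compose[OF _ R(1)]) auto
    then show "continuous_on U (\<lambda>x. blinfun_apply (Blinfun (\<psi>' x)) i)"
      by (simp add: bounded_linear_Blinfun_apply[OF bl] \<psi>'_def cong: continuous_on_cong)
  qed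
  \<comment> \<open>\<open>L\<close> is the derivative of \<open>N\<close> at \<open>y\<close>
    itself, so the correction in \<open>\<psi>'\<close> vanishes there.\<close>
  have "\<psi>' y = id" unfolding \<psi>'_def using L linear_0[OF R(1)] by auto
  then have id: "id_blinfun o\<^sub>L Blinfun (\<psi>' y) = id_blinfun"
    by (auto intro!: blinfun_eqI simp: bounded_linear_Blinfun_apply id_def)
  obtain U' V g g' where
    inv: "open U'" "U' \<subseteq> U" "y \<in> U'" "open V" "\<psi> y \<in> V" "homeomorphism U' V \<psi> g"
    and g': "\<And>z. z \<in> V \<Longrightarrow> (g has_derivative (g' z)) (at z)"
      "\<And>z. z \<in> V \<Longrightarrow> g' z = inv (blinfun_apply (Blinfun (\<psi>' (g z))))"
      "\<And>z. z \<in> V \<Longrightarrow> bij (blinfun_apply (Blinfun (\<psi>' (g z))))"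
    using inverse_function_theorem[OF assms(1) _ cont assms(2) id] d\<psi> bounded_linear_Blinfun_apply[OF bl]
    by metis
  have y: "\<psi> y = y" unfolding \<psi>_def by (simp add: linear_0[OF R(1)] linear_0[OF L'])
  obtain r where r: "0 < r" "ball y r \<subseteq> V"
    using inv(4,5) y open_contains_ball by metis
  have gU: "g z \<in> U" if "z \<in> V" for z
    using inv(2,6) that unfolding homeomorphism_def by blast
  have \<psi>g: "\<psi> (g z) = z" if "z \<in> V" for z
    using inv(6) that unfolding homeomorphism_def by blast
  have e: "\<psi>' (g z) (g' z v) = v" if "z \<in> V" for z v
    using g'(2,3)[OF that] bounded_linear_Blinfun_apply[OF bl[OF gU[OF that]]]
    by (metis bij_inv_eq_iff)
  show ?thesis
  proof
    show "0 < r" by fact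
    show "g y = y" using inv(3,6) y unfolding homeomorphism_def by metis
    show "g ` ball y r \<subseteq> U" using gU r(2) by blast
    have "g ` ball y r = U' \<inter> \<psi> -` ball y r"
      using inv(6) r(2) unfolding homeomorphism_def by (force simp: image_iff)
    moreover have "continuous_on U' \<psi>" using inv(6) unfolding homeomorphism_def by blast
    ultimately show "open (g ` ball y r)"
      using inv(1) by (metis continuous_open_preimage open_ball)
    fix z assume z: "z \<in> ball y r"
    then have zV: "z \<in> V" using r(2) by blast
    show "(g has_derivative g' z) (at z)" using g'(1)[OF zV] .
    show "N (g z) = N y + L (z - y)" using L\<psi>[of "g z"] \<psi>g[OF zV] by simp
    fix v
    \<comment> \<open>For \<open>v\<close> in the range of \<open>R\<close> this keeps
      \<open>g' z v\<close> in that range, which later identifies the velocity of a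
      transversal.\<close>
    show "g' z v + R (?N' (g z) (g' z v) - L (g' z v)) = v"
      using e[OF zV, of v] unfolding \<psi>'_def .
    show "?N' (g z) (g' z v) = L v"
      using L\<psi>'[of "g z" "g' z v"] e[OF zV, of v] by simp
  qed
qed

text \<open>Two points of the ball with the same value of \<open>L\<close> are joined by a segment
  inside the ball with direction in the kernel of \<open>L\<close>; along it
  \<open>F (\<phi> z)\<close> has derivative zero.\<close>

lemma functional_dependence_coordinates:
  fixes \<phi> :: "'a::euclidean_space \<Rightarrow> 'a" and F :: "'a \<Rightarrow> 'c::euclidean_space" and L :: "'a \<Rightarrow> 'b::euclidean_space"
  assumes "linear L"
    and \<phi>: "\<And>z. z \<in> ball y r \<Longrightarrow> (\<phi> has_derivative \<phi>' z) (at z)"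
    and F: "\<And>z. z \<in> ball y r \<Longrightarrow> (F has_derivative F' (\<phi> z)) (at (\<phi> z))"
    and ker: "\<And>z v. z \<in> ball y r \<Longrightarrow> L v = 0 \<Longrightarrow> F' (\<phi> z) (\<phi>' z v) = 0"
    and z: "z \<in> ball y r" "z' \<in> ball y r" "L z = L z'"
  shows "F (\<phi> z) = F (\<phi> z')"
proof -
  let ?c = "\<lambda>s::real. z + s *\<^sub>R (z' - z)"
  have c: "?c s \<in> ball y r" if "s \<in> {0..1}" for s
  proof -
    have "(1 - s) *\<^sub>R z + s *\<^sub>R z' \<in> ball y r"
      using z that by (intro convexD_alt[OF convex_ball]) auto
    then show ?thesis by (simp add: algebra_simps)
  qed
  have L0: "L (h *\<^sub>R (z' - z)) = 0" for h
    using assms(1) z(3) by (simp add: linear_diff linear_scale)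
  have "((\<lambda>s. F (\<phi> (?c s))) has_derivative (\<lambda>h. 0)) (at s within {0..1})" if "s \<in> {0..1}" for s
  proof -
    have "(?c has_derivative (\<lambda>h. h *\<^sub>R (z' - z))) (at s within {0..1})"
      by (auto intro!: derivative_eq_intros)
    note d = has_derivative_compose[OF has_derivative_compose[OF this \<phi>[OF c[OF that]]] F[OF c[OF that]]]
    then show ?thesis using ker[OF c[OF that] L0] by simp
  qed
  then have "F (\<phi> (?c 0)) = F (\<phi> (?c 1))"
    by (intro has_derivative_zero_unique[of "{0..1::real}" "\<lambda>s. F (\<phi> (?c s))"]) auto
  then show ?thesis by simp
qed

text \<open>The kernel condition is infinitesimal. With \<open>W\<close> the image of a ball in
  adapted coordinates, the fibres of \<open>N\<close> in \<open>W\<close> are images of convex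
  slices, so the condition integrates.\<close>

lemma functional_dependence:
  fixes N :: "'a::euclidean_space \<Rightarrow> 'b::euclidean_space" and F :: "'a \<Rightarrow> 'c::euclidean_space"
  assumes "open U" "y \<in> U" "smooth_on N U"
    and F: "\<And>x. x \<in> U \<Longrightarrow> (F has_derivative F' x) (at x)"
    and surj: "surj (frechet_derivative N (at y))"
    and ker: "\<And>x w. x \<in> U \<Longrightarrow> frechet_derivative N (at x) w = 0 \<Longrightarrow> F' x w = 0"
  obtains W where "open W" "y \<in> W" "W \<subseteq> U" "\<And>x x'. x \<in> W \<Longrightarrow> x' \<in> W \<Longrightarrow> N x = N x' \<Longrightarrow> F x = F x'"
proof -
  let ?L = "frechet_derivative N (at y)"
  have L: "linear ?L" using smooth_on_has_derivative[OF assms(1,3,2)] has_derivative_linear by blast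
  obtain R where R: "linear R" "\<And>t. ?L (R t) = t"
    using linear_surjective_right_inverse[OF L surj] by (metis comp_apply id_apply)
  obtain r \<phi> \<phi>' where *: "0 < r" "\<phi> y = y" "\<phi> ` ball y r \<subseteq> U" "open (\<phi> ` ball y r)"
    "\<And>z. z \<in> ball y r \<Longrightarrow> (\<phi> has_derivative \<phi>' z) (at z)"
    "\<And>z. z \<in> ball y r \<Longrightarrow> N (\<phi> z) = N y + ?L (z - y)"
    "\<And>z v. z \<in> ball y r \<Longrightarrow> frechet_derivative N (at (\<phi> z)) (\<phi>' z v) = ?L v"
    by (rule submersion_coordinates[OF assms(1-3) refl R]) blast
  show ?thesis
  proof
    show "open (\<phi> ` ball y r)" "\<phi> ` ball y r \<subseteq> U" by fact+
    show "y \<in> \<phi> ` ball y r" using *(1,2) by (force intro: rev_image_eqI[of y])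
    fix x x' assume "x \<in> \<phi> ` ball y r" "x' \<in> \<phi> ` ball y r" "N x = N x'"
    then obtain z z' where z: "z \<in> ball y r" "z' \<in> ball y r" "x = \<phi> z" "x' = \<phi> z'" "N (\<phi> z) = N (\<phi> z')"
      by blast
    then have "?L z = ?L z'" by (simp add: *(6) linear_diff[OF L])
    then show "F x = F x'"
      unfolding z(3,4) using *(3,7) z(1,2)
      by (intro functional_dependence_coordinates[OF L *(5) F]) (auto intro!: ker)
  qed
qed

section \<open>Moving frames on a hypersurface\<close>

lemma exhaust_5:
  fixes x :: 5
  shows "x = 0 \<or> x = 1 \<or> x = 2 \<or> x = 3 \<or> x = 4"
proof (induct x)
  case (of_int z)
  then have "z = 0 \<or> z = 1 \<or> z = 2 \<or> z = 3 \<or> z = 4" by fastforce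
  then show ?case by auto
qed

lemma forall_5: "(\<forall>i::5. P i) \<longleftrightarrow> P 0 \<and> P 1 \<and> P 2 \<and> P 3 \<and> P 4"
  by (metis exhaust_5)

lemma UNIV_5: "UNIV = {0, 1, 2, 3, 4::5}"
  using exhaust_5 by auto

lemma sum_5: "sum f (UNIV::5 set) = f 0 + f 1 + f 2 + f 3 + f 4"
  unfolding UNIV_5 by (simp add: ac_simps)

lemma matrix_inv_mult:
  fixes A :: "'a::field^'n^'n"
  assumes "invertible A"
  shows "A ** matrix_inv A = mat 1" "matrix_inv A ** A = mat 1"
  using someI_ex[OF assms[unfolded invertible_def]] unfolding matrix_inv_def by blast+

lemma matrix_mult_row: "(M ** A) $ u = (\<Sum>v\<in>UNIV. M $ u $ v *\<^sub>R A $ v)"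
  for M :: "real^'n^'m" and A :: "real^'k^'n"
  by (simp add: matrix_matrix_mult_def vec_eq_iff sum_component)

text \<open>The columns of the inverse form the basis dual to the rows; pairing with them isolates
  one coefficient at a time.\<close>

lemma invertible_row_unique:
  fixes A :: "real^5^5"
  assumes "invertible A"
    and "c0 *\<^sub>R A $ 0 + c1 *\<^sub>R A $ 1 + c2 *\<^sub>R A $ 2 + c3 *\<^sub>R A $ 3 + c4 *\<^sub>R A $ 4 = 0"
  shows "c0 = 0" "c1 = 0" "c2 = 0" "c3 = 0" "c4 = 0"
proof -
  have "(A ** matrix_inv A) $ u $ v = A $ u \<bullet> column v (matrix_inv A)" for u v
    by (simp add: matrix_matrix_mult_def inner_vec_def column_def)
  then have d: "A $ u \<bullet> column v (matrix_inv A) = (if u = v then 1 else 0)" for u v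
    using matrix_inv_mult(1)[OF assms(1)] by (simp add: mat_def)
  have "(c0 *\<^sub>R A $ 0 + c1 *\<^sub>R A $ 1 + c2 *\<^sub>R A $ 2 + c3 *\<^sub>R A $ 3 + c4 *\<^sub>R A $ 4) \<bullet> column v (matrix_inv A) = 0" for v
    using assms(2) by simp
  from this[of 0] this[of 1] this[of 2] this[of 3] this[of 4]
  show "c0 = 0" "c1 = 0" "c2 = 0" "c3 = 0" "c4 = 0"
    by (simp_all add: inner_add_left d)
qed

lemma invertible_orthogonal_rows:
  fixes A :: "real^5^5"
  assumes "invertible A" "\<And>u. v \<bullet> A $ u = 0"
  shows "v = 0"
proof -
  have "A *v v = 0"
    using assms(2) by (simp add: matrix_vector_mult_def vec_eq_iff inner_vec_def mult.commute)
  then have "matrix_inv A *v (A *v v) = 0" by simp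
  then show ?thesis by (simp add: matrix_vector_mul_assoc matrix_inv_mult(2)[OF assms(1)])
qed

lemma span_insert_range_linear:
  assumes "linear D"
  shows "span (insert p (range D)) = {c *\<^sub>R p + D w | c w. True}"
proof -
  have r: "span (range D) = range D"
    using assms by (simp add: linear_subspace_image span_eq_iff)
  show ?thesis
  proof (intro set_eqI iffI)
    fix x assume "x \<in> span (insert p (range D))"
    then obtain k where "x - k *\<^sub>R p \<in> range D" unfolding span_insert r by blast
    then obtain w where "x - k *\<^sub>R p = D w" by blast
    then have "x = k *\<^sub>R p + D w" by (simp add: algebra_simps)
    then show "x \<in> {c *\<^sub>R p + D w | c w. True}" by blast
  next
    fix x assume "x \<in> {c *\<^sub>R p + D w | c w. True}"
    then obtain c w where x: "x = c *\<^sub>R p + D w" by blast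
    show "x \<in> span (insert p (range D))"
      unfolding x by (intro span_add span_scale span_base) auto
  qed
qed

lemma frame_derivative:
  assumes "open U" "smooth_on A U" "x \<in> U" "invertible (A x)"
  shows "((\<lambda>y. A y $ u) has_derivative (\<lambda>w. \<Sum>v\<in>UNIV. frame_form A u v x w *\<^sub>R A x $ v)) (at x)"
proof -
  let ?D = "frechet_derivative A (at x)"
  have "(A has_derivative ?D) (at x)" using smooth_on_has_derivative[OF assms(1-3)] .
  then have "((\<lambda>y. A y $ u) has_derivative (\<lambda>w. ?D w $ u)) (at x)"
    by (rule bounded_linear.has_derivative[OF bounded_linear_vec_nth])
  moreover have "?D w = (?D w ** matrix_inv (A x)) ** A x" for w
    by (simp add: matrix_inv_mult(2)[OF assms(4)] flip: matrix_mul_assoc)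
  then have "?D w $ u = (\<Sum>v\<in>UNIV. frame_form A u v x w *\<^sub>R A x $ v)" for w
    unfolding frame_form_def by (subst matrix_mult_row[symmetric]) (rule arg_cong)
  ultimately show ?thesis by simp
qed

lemma linear_frame_form:
  assumes "open U" "smooth_on A U" "x \<in> U"
  shows "linear (frame_form A u v x)"
proof -
  have D: "linear (frechet_derivative A (at x))"
    using smooth_on_has_derivative[OF assms] has_derivative_linear by blast
  then show ?thesis
    unfolding frame_form_def
    by (auto intro!: linearI simp: linear_add[OF D] linear_scale[OF D] matrix_matrix_mult_def distrib_right
        sum.distrib sum_distrib_left mult.assoc)
qed

lemma dim_span_4_le: "dim (span {a, b, c, d}) \<le> 4"
proof -
  have "dim {a,b,c,d} \<le> card {a,b,c,d}" by (rule dim_le_card') simp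
  also have "\<dots> \<le> 4" by (simp add: card_insert_if)
  finally show ?thesis by simp
qed

section \<open>Consequences of the adapted frame equations\<close>

locale adapted_hypersurface =
  fixes f :: "real^3 \<Rightarrow> real^5" and U :: "(real^3) set" and A :: "real^3 \<Rightarrow> real^5^5"
  assumes hypersurface: "hypersurface f U" and adapted: "adapted_frame f U A"
begin

lemma open_U: "open U" and smooth_f: "smooth_on f U"
  using hypersurface unfolding hypersurface_def by auto

lemma smooth_A: "smooth_on A U"
  using adapted unfolding adapted_frame_def double_focus_frame_def frame_field_def by blast

lemma invertible_A: "x \<in> U \<Longrightarrow> invertible (A x)"
  using adapted unfolding adapted_frame_def double_focus_frame_def frame_field_def by blast

lemma frame_forms_zero: "x \<in> U \<Longrightarrow> frame_form A 0 4 x w = 0"  "x \<in> U \<Longrightarrow> frame_form A 1 4 x w = 0"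
  using adapted unfolding adapted_frame_def double_focus_frame_def frame_coeffs_def by blast+

lemma adapted_forms:
  assumes "x \<in> U"
  obtains b23 b33 c32 where "b23 \<noteq> 0" "c32 \<noteq> 0"
    "\<And>w. frame_form A 2 4 x w = b23 * frame_form A 0 3 x w"
    "\<And>w. frame_form A 3 4 x w = b23 * frame_form A 0 2 x w + b33 * frame_form A 0 3 x w"
    "\<And>w. frame_form A 1 2 x w = c32 * frame_form A 0 3 x w"
    "\<And>w. frame_form A 1 3 x w = 0"
proof -
  from adapted obtain b23 b33 c32 :: "real^3 \<Rightarrow> real" where *: "\<forall>x\<in>U. b23 x \<noteq> 0 \<and> c32 x \<noteq> 0 \<and>
        (\<forall>w. let \<omega> = (\<lambda>u v. frame_form A u v x w) in
           \<omega> 2 4 = b23 x * \<omega> 0 3 \<and>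
           \<omega> 3 4 = b23 x * \<omega> 0 2 + b33 x * \<omega> 0 3 \<and>
           \<omega> 1 2 = c32 x * \<omega> 0 3 \<and>
           \<omega> 1 3 = 0)"
    unfolding adapted_frame_def by blast
  show thesis
    by (rule that[of "b23 x" "c32 x" "b33 x"]) (use * assms in \<open>simp_all add: Let_def\<close>)
qed

lemma derivative_A:
  assumes "x \<in> U"
  shows "((\<lambda>y. A y $ u) has_derivative (\<lambda>w. frame_form A u 0 x w *\<^sub>R A x $ 0 + frame_form A u 1 x w *\<^sub>R A x $ 1
     + frame_form A u 2 x w *\<^sub>R A x $ 2 + frame_form A u 3 x w *\<^sub>R A x $ 3 + frame_form A u 4 x w *\<^sub>R A x $ 4)) (at x)"
  using frame_derivative[OF open_U smooth_A assms invertible_A[OF assms], of u] by (simp add: sum_5)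

lemma linear_form: "x \<in> U \<Longrightarrow> linear (frame_form A u v x)"
  using linear_frame_form[OF open_U smooth_A] .

text \<open>Differentiating f = h A_0 with \<omega>_0^4 = 0 keeps the tangent space in the span of
  the first four frame vectors, and dimension 4 forces equality. Equality in turn lets \<omega>_0^1,
  \<omega>_0^2, \<omega>_0^3 take arbitrary values together, which is how independence of the basis
  forms enters later.\<close>

lemma tangent_and_basis_forms:
  assumes x: "x \<in> U"
  shows "proj_tangent f x = span {A x $ 0, A x $ 1, A x $ 2, A x $ 3}"
    and "\<exists>w. frame_form A 0 1 x w = c1 \<and> frame_form A 0 2 x w = c2 \<and> frame_form A 0 3 x w = c3"
proof -
  let ?\<omega> = "\<lambda>u v w. frame_form A u v x w" and ?D = "frechet_derivative f (at x)"
  \<comment> \<open>The frame fixes only the line through \<open>f y\<close>; the quotient expresses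
    the factor by differentiable functions.\<close>
  define h where "h y = (f y \<bullet> A y $ 0) / (A y $ 0 \<bullet> A y $ 0)" for y
  have A0: "A y $ 0 \<noteq> 0" if "y \<in> U" for y
    using invertible_row_unique(1)[OF invertible_A[OF that], of 1 0 0 0 0] by auto
  have fh: "f y = h y *\<^sub>R A y $ 0" if "y \<in> U" for y
  proof -
    have "span {A y $ 0} = span {f y}"
      using adapted that unfolding adapted_frame_def double_focus_frame_def frame_field_def by blast
    then have "f y \<in> span {A y $ 0}" by (simp add: span_base)
    then obtain c where "f y = c *\<^sub>R A y $ 0" by (auto simp: span_singleton)
    then show ?thesis using A0[OF that] unfolding h_def by simp
  qed
  have df: "(f has_derivative ?D) (at x)" using smooth_on_has_derivative[OF open_U smooth_f x] .
  note dA0 = derivative_A[OF x, of 0]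
  have "A x $ 0 \<bullet> A x $ 0 \<noteq> 0" using A0[OF x] by simp
  note has_derivative_divide[OF has_derivative_inner[OF df dA0] has_derivative_inner[OF dA0 dA0] this]
  then obtain h' where h': "(h has_derivative h') (at x)"
    unfolding h_def by blast
  have "(f has_derivative (\<lambda>w. h x *\<^sub>R (?\<omega> 0 0 w *\<^sub>R A x $ 0 + ?\<omega> 0 1 w *\<^sub>R A x $ 1 + ?\<omega> 0 2 w *\<^sub>R A x $ 2
     + ?\<omega> 0 3 w *\<^sub>R A x $ 3 + ?\<omega> 0 4 w *\<^sub>R A x $ 4) + h' w *\<^sub>R A x $ 0)) (at x)"
    by (rule has_derivative_transform_within_open[OF has_derivative_scaleR[OF h' dA0] open_U x]) (simp add: fh)
  then have D: "?D w = (h x * ?\<omega> 0 0 w + h' w) *\<^sub>R A x $ 0 + (h x * ?\<omega> 0 1 w) *\<^sub>R A x $ 1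
     + (h x * ?\<omega> 0 2 w) *\<^sub>R A x $ 2 + (h x * ?\<omega> 0 3 w) *\<^sub>R A x $ 3" for w
    using has_derivative_unique[OF df] frame_forms_zero(1)[OF x] by (simp add: algebra_simps)
  have T: "proj_tangent f x = {c *\<^sub>R f x + ?D w | c w. True}"
    unfolding proj_tangent_def by (rule span_insert_range_linear[OF has_derivative_linear[OF df]])
  let ?S = "span {A x $ 0, A x $ 1, A x $ 2, A x $ 3}"
  have "?D w \<in> ?S" for w unfolding D by (intro span_add span_scale span_base) auto
  moreover have "f x \<in> ?S" unfolding fh[OF x] by (intro span_scale span_base) auto
  ultimately have "c *\<^sub>R f x + ?D w \<in> ?S" for c w by (intro span_add span_scale)
  then have sub: "proj_tangent f x \<subseteq> ?S" unfolding T by blast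
  moreover have "dim ?S \<le> dim (proj_tangent f x)"
    using dim_span_4_le[of "A x $ 0"] hypersurface x unfolding hypersurface_def by simp
  ultimately show S: "proj_tangent f x = ?S"
    unfolding proj_tangent_def by (intro subspace_dim_equal subspace_span)
  have "c1 *\<^sub>R A x $ 1 + c2 *\<^sub>R A x $ 2 + c3 *\<^sub>R A x $ 3 \<in> proj_tangent f x"
    unfolding S by (intro span_add span_scale span_base) auto
  then obtain c w where "c1 *\<^sub>R A x $ 1 + c2 *\<^sub>R A x $ 2 + c3 *\<^sub>R A x $ 3 = c *\<^sub>R f x + ?D w"
    unfolding T by blast
  then have "(- (c * h x + h x * ?\<omega> 0 0 w + h' w)) *\<^sub>R A x $ 0 + (c1 - h x * ?\<omega> 0 1 w) *\<^sub>R A x $ 1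
     + (c2 - h x * ?\<omega> 0 2 w) *\<^sub>R A x $ 2 + (c3 - h x * ?\<omega> 0 3 w) *\<^sub>R A x $ 3 + 0 *\<^sub>R A x $ 4 = 0"
    unfolding D fh[OF x] by (simp add: algebra_simps)
  from invertible_row_unique[OF invertible_A[OF x] this]
  show "\<exists>w. ?\<omega> 0 1 w = c1 \<and> ?\<omega> 0 2 w = c2 \<and> ?\<omega> 0 3 w = c3"
    by (intro exI[of _ "h x *\<^sub>R w"]) (simp add: linear_scale[OF linear_form[OF x]])
qed

text \<open>The Gauss map is a submersion onto its image transversally to the leaves, so it separates the
  leaves locally; its components are taken in the frame at \<open>y\<close>.\<close>
lemma constant_on_generator:
  fixes F :: "real^3 \<Rightarrow> real"
  assumes gauss: "has_gauss_rank f U 2"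
    and V: "open V" "y \<in> V" "V \<subseteq> U"
    and F: "\<And>x. x \<in> V \<Longrightarrow> (F has_derivative F' x) (at x)"
    and ker: "\<And>x w. x \<in> V \<Longrightarrow> frame_form A 0 2 x w = 0 \<Longrightarrow> frame_form A 0 3 x w = 0 \<Longrightarrow> F' x w = 0"
  obtains W where "open W" "y \<in> W" "W \<subseteq> V" "\<And>z. z \<in> W \<Longrightarrow> f z \<in> span {A y $ 0, A y $ 1} \<Longrightarrow> F z = F y"
proof -
  have yU: "y \<in> U" using V by blast
  obtain \<nu> :: "real^3 \<Rightarrow> real^5" where smooth_\<nu>: "smooth_on \<nu> U" and \<nu>0: "\<And>x. x \<in> U \<Longrightarrow> \<nu> x \<noteq> 0"
    and \<nu>T: "\<And>x w. x \<in> U \<Longrightarrow> w \<in> proj_tangent f x \<Longrightarrow> \<nu> x \<bullet> w = 0"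
    using gauss unfolding has_gauss_rank_def by blast
  obtain V' where V': "open V'" "y \<in> V'"
    and leaf: "{z\<in>V'. proj_tangent f z = proj_tangent f y} = {z\<in>V'. f z \<in> span {A y $ 0, A y $ 1}}"
    using adapted yU unfolding adapted_frame_def double_focus_frame_def frame_field_def generator_def
    by blast
  have \<nu>A: "\<nu> x \<bullet> A x $ 0 = 0" "\<nu> x \<bullet> A x $ 1 = 0" "\<nu> x \<bullet> A x $ 2 = 0" "\<nu> x \<bullet> A x $ 3 = 0" if "x \<in> U" for x
    by (rule \<nu>T[OF that], unfold tangent_and_basis_forms(1)[OF that], simp add: span_base)+
  have \<nu>A4: "\<nu> x \<bullet> A x $ 4 \<noteq> 0" if "x \<in> U" for x
  proof
    assume "\<nu> x \<bullet> A x $ 4 = 0"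
    then have "\<nu> x \<bullet> A x $ u = 0" for u using \<nu>A[OF that] exhaust_5[of u] by auto
    then show False using invertible_orthogonal_rows[OF invertible_A[OF that]] \<nu>0[OF that] by blast
  qed
  let ?\<nu>' = "\<lambda>x. frechet_derivative \<nu> (at x)"
  have d\<nu>: "(\<nu> has_derivative ?\<nu>' x) (at x)" if "x \<in> U" for x
    using smooth_on_has_derivative[OF open_U smooth_\<nu> that] .
  \<comment> \<open>Differentiating the relation between \<open>\<nu>\<close> and the row
    \<open>u\<close> leaves only the \<omega>_u^4 term, since \<open>\<nu>\<close> kills the rows 0
    to 3.\<close>
  have \<nu>'A: "?\<nu>' x w \<bullet> A x $ u = - frame_form A u 4 x w * (\<nu> x \<bullet> A x $ 4)"
    if x: "x \<in> U" and u: "u \<noteq> 4" for x w u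
  proof -
    have 0: "\<nu> z \<bullet> A z $ u = 0" if "z \<in> U" for z
      using exhaust_5[of u] by (elim disjE) (use \<nu>A[OF that] u in simp_all)
    note has_derivative_transform_within_open[OF has_derivative_inner[OF d\<nu>[OF x] derivative_A[OF x, of u]] open_U x 0]
    from has_derivative_unique[OF this has_derivative_const]
    have "\<nu> x \<bullet> (frame_form A u 0 x w *\<^sub>R A x $ 0 + frame_form A u 1 x w *\<^sub>R A x $ 1
     + frame_form A u 2 x w *\<^sub>R A x $ 2 + frame_form A u 3 x w *\<^sub>R A x $ 3 + frame_form A u 4 x w *\<^sub>R A x $ 4)
      + ?\<nu>' x w \<bullet> A x $ u = 0" by (rule fun_cong)
    then show ?thesis by (simp add: inner_add_right \<nu>A[OF x])
  qed
  \<comment> \<open>Where both basis forms vanish, so do all \<omega>_u^4 with u different from 4;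
    the derivative of \<open>\<nu>\<close> is then a multiple of \<open>\<nu>\<close>, so the Gauss
    image is stationary as a projective point.\<close>
  have parallel: "\<exists>c. ?\<nu>' x w = c *\<^sub>R \<nu> x"
    if x: "x \<in> U" and w: "frame_form A 0 2 x w = 0" "frame_form A 0 3 x w = 0" for x w
  proof -
    obtain b23 b33 c32 where "b23 \<noteq> 0" "c32 \<noteq> 0" and b: "\<And>w. frame_form A 2 4 x w = b23 * frame_form A 0 3 x w"
      "\<And>w. frame_form A 3 4 x w = b23 * frame_form A 0 2 x w + b33 * frame_form A 0 3 x w"
      "\<And>w. frame_form A 1 2 x w = c32 * frame_form A 0 3 x w" "\<And>w. frame_form A 1 3 x w = 0"
      by (rule adapted_forms[OF x], rule that, assumption+)
    have 0: "frame_form A u 4 x w = 0" if "u \<noteq> 4" for u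
      using b(1,2)[of w] frame_forms_zero[OF x] w that exhaust_5[of u] by auto
    define c where "c = (?\<nu>' x w \<bullet> A x $ 4) / (\<nu> x \<bullet> A x $ 4)"
    have "(?\<nu>' x w - c *\<^sub>R \<nu> x) \<bullet> A x $ u = 0" for u
    proof (cases "u = 4")
      case True
      then show ?thesis using \<nu>A4[OF x] by (simp add: c_def inner_diff_left)
    next
      case False
      then have "\<nu> x \<bullet> A x $ u = 0" using \<nu>A[OF x] exhaust_5[of u] by auto
      then show ?thesis using \<nu>'A[OF x False] 0[OF False] by (simp add: inner_diff_left)
    qed
    then have "?\<nu>' x w - c *\<^sub>R \<nu> x = 0" using invertible_orthogonal_rows[OF invertible_A[OF x]] by blast
    then show ?thesis by (intro exI[of _ c]) simp
  qed
  \<comment> \<open>Affine coordinates of the Gauss map: the quotient removes the scaling of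
    \<open>\<nu>\<close>. At \<open>y\<close> the conormal pairs only with \<open>A y $ 4\<close>,
    so \<open>n 2\<close> and \<open>n 3\<close> vanish there, with derivatives -\<omega>_2^4 and
    -\<omega>_3^4.\<close>
  define n where "n u z = (\<nu> z \<bullet> A y $ u) * inverse (\<nu> z \<bullet> A y $ 4)" for u z
  define V2 where "V2 = {z \<in> V \<inter> V'. \<nu> z \<bullet> A y $ 4 \<noteq> 0}"
  have oVV: "open (V \<inter> V')" using V(1) V'(1) by blast
  have V2U: "V2 \<subseteq> U" and V2V: "V2 \<subseteq> V" and V2V': "V2 \<subseteq> V'" using V(3) unfolding V2_def by auto
  have yV2: "y \<in> V2" using V(2) V'(2) \<nu>A4[OF yU] unfolding V2_def by blast
  have cont: "continuous_on (V \<inter> V') (\<lambda>z. \<nu> z \<bullet> A y $ 4)"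
    by (intro continuous_intros continuous_on_subset[OF smooth_on_imp_continuous_on[OF smooth_\<nu>]])
      (use V(3) in blast)
  have oV2: "open V2"
    using continuous_open_preimage[OF cont oVV, of "- {0}"] unfolding V2_def
    by (simp add: vimage_def Int_def conj_ac open_Compl)
  have sn: "smooth_on (n u) V2" for u
    unfolding n_def using V2U smooth_on_subset[OF smooth_\<nu>]
    by (intro smooth_on_bilinear[OF oV2 bounded_bilinear_mult] smooth_on_inverse oV2
        smooth_on_linear[OF oV2 bounded_linear_inner_left]) (auto simp: V2_def)
  have dn: "frechet_derivative (n u) (at x) w =
      (?\<nu>' x w \<bullet> A y $ u) / (\<nu> x \<bullet> A y $ 4) - (\<nu> x \<bullet> A y $ u) * (?\<nu>' x w \<bullet> A y $ 4) / (\<nu> x \<bullet> A y $ 4)\<^sup>2"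
    if x: "x \<in> V2" for u x w
  proof -
    have xU: "x \<in> U" and x4: "\<nu> x \<bullet> A y $ 4 \<noteq> 0" using x V2U unfolding V2_def by auto
    have "((\<lambda>z. (\<nu> z \<bullet> A y $ u) * inverse (\<nu> z \<bullet> A y $ 4)) has_derivative (\<lambda>w. (\<nu> x \<bullet> A y $ u) * - (inverse (\<nu> x \<bullet> A y $ 4) * (?\<nu>' x w \<bullet> A y $ 4) * inverse (\<nu> x \<bullet> A y $ 4))
       + (?\<nu>' x w \<bullet> A y $ u) * inverse (\<nu> x \<bullet> A y $ 4))) (at x)"
      by (intro has_derivative_mult Deriv.has_derivative_inverse x4 has_derivative_inner_left d\<nu> xU)
    then have "(n u has_derivative (\<lambda>w. (\<nu> x \<bullet> A y $ u) * - (inverse (\<nu> x \<bullet> A y $ 4) * (?\<nu>' x w \<bullet> A y $ 4) * inverse (\<nu> x \<bullet> A y $ 4))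
       + (?\<nu>' x w \<bullet> A y $ u) * inverse (\<nu> x \<bullet> A y $ 4))) (at x)"
      unfolding n_def .
    from fun_cong[OF frechet_derivative_at[OF this, symmetric], of w] show ?thesis
      using x4 by (simp add: field_simps power2_eq_square)
  qed
  have dn0: "frechet_derivative (n u) (at x) w = 0"
    if x: "x \<in> V2" and w: "frame_form A 0 2 x w = 0" "frame_form A 0 3 x w = 0" for x w u
  proof -
    have xU: "x \<in> U" and x4: "\<nu> x \<bullet> A y $ 4 \<noteq> 0" using x V2U unfolding V2_def by auto
    obtain c where "?\<nu>' x w = c *\<^sub>R \<nu> x" using parallel[OF xU w] by blast
    then show ?thesis using x4 by (simp add: dn[OF x] power2_eq_square)
  qed
  have dn_lin: "linear (frechet_derivative (n u) (at x))" if "x \<in> V2" for x u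
    using smooth_on_has_derivative[OF oV2 sn that] has_derivative_linear by blast
  have dny: "frechet_derivative (n u) (at y) w = - frame_form A u 4 y w" if "u \<in> {2, 3}" for u w
    using \<nu>'A[OF yU, of u] \<nu>A[OF yU] \<nu>A4[OF yU] that by (auto simp: dn[OF yV2])
  obtain b23 b33 c32 where b: "b23 \<noteq> 0" and "c32 \<noteq> 0" and b': "\<And>w. frame_form A 2 4 y w = b23 * frame_form A 0 3 y w"
      "\<And>w. frame_form A 3 4 y w = b23 * frame_form A 0 2 y w + b33 * frame_form A 0 3 y w"
      "\<And>w. frame_form A 1 2 y w = c32 * frame_form A 0 3 y w" "\<And>w. frame_form A 1 3 y w = 0"
    by (rule adapted_forms[OF yU], rule that, assumption+)
  have surj: "\<exists>w. frechet_derivative (n 2) (at y) w = s \<and> frechet_derivative (n 3) (at y) w = t" for s t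
  proof -
    \<comment> \<open>These values solve the triangular system -b23 \<omega>_0^3 = s, -(b23
      \<omega>_0^2 + b33 \<omega>_0^3) = t.\<close>
    obtain w where "frame_form A 0 2 y w = (- t + b33 * s / b23) / b23" "frame_form A 0 3 y w = - s / b23"
      using tangent_and_basis_forms(2)[OF yU] by metis
    then show ?thesis using b by (intro exI[of _ w]) (simp add: dny b'(1,2))
  qed
  obtain e1 where e1: "frechet_derivative (n 2) (at y) e1 = 1" "frechet_derivative (n 3) (at y) e1 = 0"
    using surj by blast
  obtain e2 where e2: "frechet_derivative (n 2) (at y) e2 = 0" "frechet_derivative (n 3) (at y) e2 = 1"
    using surj by blast
  \<comment> \<open>The minor of the two derivatives is nonzero at \<open>y\<close>, hence on the
    open set \<open>V3\<close>, where the rank stays two.\<close>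
  define \<Delta> where "\<Delta> x v w = frechet_derivative (n 2) (at x) v * frechet_derivative (n 3) (at x) w
      - frechet_derivative (n 2) (at x) w * frechet_derivative (n 3) (at x) v" for x v w
  define V3 where "V3 = {x \<in> V2. \<Delta> x e1 e2 \<noteq> 0}"
  have "continuous_on V2 (\<lambda>x. \<Delta> x e1 e2)"
    unfolding \<Delta>_def using smooth_on_imp_continuous_on[OF smooth_on_frechet_derivative[OF sn]]
    by (intro continuous_intros)
  from continuous_open_preimage[OF this oV2, of "- {0}"] have oV3: "open V3"
    unfolding V3_def by (simp add: vimage_def Int_def conj_ac open_Compl)
  have yV3: "y \<in> V3" unfolding V3_def \<Delta>_def using yV2 e1 e2 by simp
  \<comment> \<open>Both derivatives factor through the pair of basis forms, so every minor is the
    minor of the basis forms times \<open>\<Delta> x p q\<close>. This factor is nonzero on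
    \<open>V3\<close>, and Cramer's rule recovers the basis forms from the derivatives.\<close>
  have ker3: "frame_form A 0 2 x w = 0 \<and> frame_form A 0 3 x w = 0"
    if x: "x \<in> V3" and w: "frechet_derivative (n 2) (at x) w = 0" "frechet_derivative (n 3) (at x) w = 0" for x w
  proof -
    have x2: "x \<in> V2" and xU: "x \<in> U" using x V2U unfolding V3_def by auto
    obtain p where p: "frame_form A 0 2 x p = 1" "frame_form A 0 3 x p = 0"
      using tangent_and_basis_forms(2)[OF xU] by blast
    obtain q where q: "frame_form A 0 2 x q = 0" "frame_form A 0 3 x q = 1"
      using tangent_and_basis_forms(2)[OF xU] by blast
    have N: "frechet_derivative (n u) (at x) v = frame_form A 0 2 x v * frechet_derivative (n u) (at x) p
        + frame_form A 0 3 x v * frechet_derivative (n u) (at x) q" for u v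
    proof -
      have "frechet_derivative (n u) (at x) (v - frame_form A 0 2 x v *\<^sub>R p - frame_form A 0 3 x v *\<^sub>R q) = 0"
        by (rule dn0[OF x2])
          (simp_all add: linear_diff[OF linear_form[OF xU]] linear_scale[OF linear_form[OF xU]] p q)
      then show ?thesis by (simp add: linear_diff[OF dn_lin[OF x2]] linear_scale[OF dn_lin[OF x2]])
    qed
    have \<Delta>: "\<Delta> x v v' = (frame_form A 0 2 x v * frame_form A 0 3 x v' - frame_form A 0 2 x v' * frame_form A 0 3 x v) * \<Delta> x p q" for v v'
      unfolding \<Delta>_def N[of 2 v] N[of 2 v'] N[of 3 v] N[of 3 v'] by (simp add: algebra_simps)
    have "\<Delta> x e1 e2 \<noteq> 0" using x unfolding V3_def by blast
    then have "\<Delta> x p q \<noteq> 0" unfolding \<Delta>[of e1] by simp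
    moreover have "frame_form A 0 2 x w * \<Delta> x p q = \<Delta> x w q" "frame_form A 0 3 x w * \<Delta> x p q = \<Delta> x p w"
      unfolding \<Delta>_def N[of 2 w] N[of 3 w] by (simp_all add: algebra_simps)
    moreover have "\<Delta> x w q = 0" "\<Delta> x p w = 0" unfolding \<Delta>_def using w by simp_all
    ultimately show ?thesis by simp
  qed
  define N where "N z = (n 2 z, n 3 z)" for z
  have V3V2: "V3 \<subseteq> V2" unfolding V3_def by blast
  have sN: "smooth_on N V3"
    unfolding N_def using smooth_on_subset[OF sn V3V2] by (intro smooth_on_Pair oV3)
  have dN: "frechet_derivative N (at x) w = (frechet_derivative (n 2) (at x) w, frechet_derivative (n 3) (at x) w)"
    if "x \<in> V3" for x w
  proof -
    have "x \<in> V2" using that V3V2 by blast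
    note smooth_on_has_derivative[OF oV2 sn this]
    from has_derivative_Pair[OF this[of 2] this[of 3]] show ?thesis
      unfolding N_def by (simp flip: frechet_derivative_at)
  qed
  have sj: "surj (frechet_derivative N (at y))"
  proof (unfold surj_def, intro allI)
    fix p :: "real \<times> real"
    obtain w where "frechet_derivative (n 2) (at y) w = fst p" "frechet_derivative (n 3) (at y) w = snd p"
      using surj by blast
    then show "\<exists>w. p = frechet_derivative N (at y) w" unfolding dN[OF yV3] by (intro exI[of _ w]) (simp add: prod_eq_iff)
  qed
  have F3: "(F has_derivative F' x) (at x)" if "x \<in> V3" for x using F that V3V2 V2V by blast
  have k3: "F' x w = 0" if "x \<in> V3" "frechet_derivative N (at x) w = 0" for x w
    using ker3[of x w] ker[of x w] that V3V2 V2V by (auto simp: dN zero_prod_def)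
  obtain W where W: "open W" "y \<in> W" "W \<subseteq> V3" "\<And>x x'. x \<in> W \<Longrightarrow> x' \<in> W \<Longrightarrow> N x = N x' \<Longrightarrow> F x = F x'"
    using functional_dependence[OF oV3 yV3 sN F3 sj k3] by blast
  show ?thesis
  proof
    show "open W" "y \<in> W" by fact+
    show "W \<subseteq> V" using W(3) V3V2 V2V by blast
    fix z assume z: "z \<in> W" "f z \<in> span {A y $ 0, A y $ 1}"
    have zU: "z \<in> U" "z \<in> V'" using z W(3) V3V2 V2U V2V' by blast+
    \<comment> \<open>The common tangent hyperplane makes \<open>\<nu> z\<close> kill the rows 2 and
      3 of the frame at \<open>y\<close>, so both affine coordinates vanish at \<open>z\<close> as
      they do at \<open>y\<close>.\<close>
    have "proj_tangent f z = proj_tangent f y" using leaf z(2) zU(2) by blast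
    then have "\<nu> z \<bullet> A y $ 2 = 0" "\<nu> z \<bullet> A y $ 3 = 0"
      using \<nu>T[OF zU(1)] unfolding tangent_and_basis_forms(1)[OF yU] by (simp_all add: span_base)
    then have "N z = N y" unfolding N_def n_def using \<nu>A[OF yU] by simp
    then show "F z = F y" using W(4) z(1) W(2) by blast
  qed
qed

section \<open>The focal curve and the fiber cones\<close>

text \<open>Dividing by one coordinate of A_1 cancels the component \<omega>_1^1 A_1, and what
  remains is a multiple of \<omega>_0^3. The vector \<open>E\<close> cannot vanish, because it
  contains A_2 with the coefficient \<open>l * c32\<close>.\<close>

lemma normalized_focus_derivative:
  assumes wedge: "\<And>u v. wedge (frame_form A 1 0 x) (frame_form A 0 3 x) u v = 0"
    and x: "x \<in> U" and k: "A x $ 1 $ k \<noteq> 0"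
  defines "G \<equiv> \<lambda>y. inverse (A y $ 1 $ k) *\<^sub>R A y $ 1"
  shows "\<exists>E. E \<noteq> 0 \<and> (\<forall>w. frechet_derivative G (at x) w = frame_form A 0 3 x w *\<^sub>R E)"
proof -
  let ?\<omega> = "\<lambda>u v w. frame_form A u v x w"
  obtain b23 b33 c32 where "b23 \<noteq> 0" and c: "c32 \<noteq> 0" and b: "\<And>w. ?\<omega> 2 4 w = b23 * ?\<omega> 0 3 w"
      "\<And>w. ?\<omega> 3 4 w = b23 * ?\<omega> 0 2 w + b33 * ?\<omega> 0 3 w"
      "\<And>w. ?\<omega> 1 2 w = c32 * ?\<omega> 0 3 w" "\<And>w. ?\<omega> 1 3 w = 0"
    by (rule adapted_forms[OF x], rule that, assumption+)
  obtain w3 where w3: "?\<omega> 0 3 w3 = 1" using tangent_and_basis_forms(2)[OF x] by blast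
  define a where "a = ?\<omega> 1 0 w3"
  \<comment> \<open>Evaluating the wedge product against a vector with \<omega>_0^3 = 1 turns its
    vanishing into proportionality.\<close>
  have a: "?\<omega> 1 0 w = a * ?\<omega> 0 3 w" for w
    using wedge[of w w3] w3 unfolding wedge_def a_def by simp
  define l where "l = inverse (A x $ 1 $ k)"
  have l: "l \<noteq> 0" "l * A x $ 1 $ k = 1" using k unfolding l_def by simp_all
  define P where "P = a *\<^sub>R A x $ 0 + c32 *\<^sub>R A x $ 2"
  define D where "D w = ?\<omega> 1 1 w *\<^sub>R A x $ 1 + ?\<omega> 0 3 w *\<^sub>R P" for w
  have "((\<lambda>y. A y $ 1) has_derivative D) (at x)"
    using derivative_A[OF x, of 1] unfolding D_def P_def
    by (simp add: a b frame_forms_zero[OF x] algebra_simps)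
  note dA = this bounded_linear.has_derivative[OF bounded_linear_vec_nth[of k] this]
  have dG: "(G has_derivative (\<lambda>w. l *\<^sub>R D w + (- (l * D w $ k * l)) *\<^sub>R A x $ 1)) (at x)"
    unfolding G_def l_def by (intro has_derivative_scaleR Deriv.has_derivative_inverse dA k)
  define E where "E = l *\<^sub>R P - (l * P $ k * l) *\<^sub>R A x $ 1"
  have "frechet_derivative G (at x) w = ?\<omega> 0 3 w *\<^sub>R E" for w
  proof -
    have *: "l * (A x $ 1 $ k * (l * t)) = l * t" for t using l(2) by (simp flip: mult.assoc)
    have "l *\<^sub>R D w + (- (l * D w $ k * l)) *\<^sub>R A x $ 1 = ?\<omega> 0 3 w *\<^sub>R E"
      unfolding E_def D_def by (simp add: algebra_simps * l(2))
    then show ?thesis by (simp flip: frechet_derivative_at[OF dG])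
  qed
  moreover have "E \<noteq> 0"
  proof
    assume "E = 0"
    then have "(l * a) *\<^sub>R A x $ 0 + (- (l * P $ k * l)) *\<^sub>R A x $ 1 + (l * c32) *\<^sub>R A x $ 2 + 0 *\<^sub>R A x $ 3 + 0 *\<^sub>R A x $ 4 = 0"
      unfolding E_def P_def by (simp add: algebra_simps)
    from invertible_row_unique(3)[OF invertible_A[OF x] this] show False using l(1) c by simp
  qed
  ultimately show ?thesis by blast
qed

lemma focus_traces_and_foliates:
  assumes gauss: "has_gauss_rank f U 2"
    and wedge: "\<And>x u v. x \<in> U \<Longrightarrow> wedge (frame_form A 1 0 x) (frame_form A 0 3 x) u v = 0"
    and x0: "x0 \<in> U"
  shows "\<exists>V g I. open V \<and> x0 \<in> V \<and> V \<subseteq> U \<and> traces_curve (\<lambda>y. A y $ 1) V g I \<and> foliates_into_cones f A V g I"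
proof -
  have "A x0 $ 1 \<noteq> 0" using invertible_row_unique(2)[OF invertible_A[OF x0], of 0 1 0 0 0] by auto
  then obtain k where k: "A x0 $ 1 $ k \<noteq> 0" by (auto simp: vec_eq_iff)
  define G where "G y = inverse (A y $ 1 $ k) *\<^sub>R A y $ 1" for y
  define V0 where "V0 = {x \<in> U. A x $ 1 $ k \<noteq> 0}"
  have V0U: "V0 \<subseteq> U" unfolding V0_def by blast
  have smooth_A1: "smooth_on (\<lambda>y. A y $ u) U" for u
    by (rule smooth_on_linear[OF open_U bounded_linear_vec_nth smooth_A])
  have smooth_A1k: "smooth_on (\<lambda>y. A y $ 1 $ k) U"
    by (rule smooth_on_linear[OF open_U bounded_linear_vec_nth smooth_A1])
  have oV0: "open V0"
    using continuous_open_preimage[OF smooth_on_imp_continuous_on[OF smooth_A1k] open_U, of "- {0}"]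
    unfolding V0_def by (simp add: vimage_def Int_def open_Compl)
  have sG: "smooth_on G V0"
    unfolding G_def using smooth_on_subset[OF smooth_A1k V0U] smooth_on_subset[OF smooth_A1 V0U]
    by (intro smooth_on_bilinear[OF oV0 bounded_bilinear_scaleR] smooth_on_inverse oV0) (auto simp: V0_def)
  have Gk: "G y $ k = 1" if "y \<in> V0" for y using that unfolding G_def V0_def by simp
  have spanG: "span {A y $ 1} = span {G y}" if "y \<in> V0" for y
  proof -
    have "A y $ 1 = A y $ 1 $ k *\<^sub>R G y" using that unfolding G_def V0_def by simp
    then have "A y $ 1 \<in> span {G y}" by (metis span_base span_scale singletonI)
    moreover have "G y \<in> span {A y $ 1}" unfolding G_def by (intro span_scale span_base) simp
    ultimately show ?thesis unfolding span_eq by simp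
  qed
  have x0V0: "x0 \<in> V0" using x0 k unfolding V0_def by blast
  have E: "\<exists>E. E \<noteq> 0 \<and> (\<forall>w. frechet_derivative G (at x) w = frame_form A 0 3 x w *\<^sub>R E)" if "x \<in> V0" for x
    using normalized_focus_derivative[OF wedge, of x k] that unfolding V0_def G_def by blast
  have dG: "(G has_derivative frechet_derivative G (at x)) (at x)" if "x \<in> V0" for x
    by (rule smooth_on_has_derivative[OF oV0 sG that])
  obtain E0 where E0: "E0 \<noteq> 0" "\<And>w. frechet_derivative G (at x0) w = frame_form A 0 3 x0 w *\<^sub>R E0"
    using E[OF x0V0] by blast
  obtain j where j: "E0 $ j \<noteq> 0" using E0(1) by (auto simp: vec_eq_iff)
  \<comment> \<open>At \<open>x0\<close> the normalised focus moves in a direction with nonzero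
    coordinate \<open>j\<close>; this coordinate becomes the curve parameter.\<close>
  define \<tau> where "\<tau> y = G y $ j" for y
  have s\<tau>: "smooth_on \<tau> V0" unfolding \<tau>_def by (rule smooth_on_linear[OF oV0 bounded_linear_vec_nth sG])
  have d\<tau>: "(\<tau> has_derivative (\<lambda>w. frechet_derivative G (at x) w $ j)) (at x)" if "x \<in> V0" for x
    unfolding \<tau>_def by (rule bounded_linear.has_derivative[OF bounded_linear_vec_nth dG[OF that]])
  note \<tau>' = fun_cong[OF frechet_derivative_at[OF d\<tau>, symmetric]]
  define L where "L = frechet_derivative \<tau> (at x0)"
  have linL: "linear L" unfolding L_def
    using smooth_on_has_derivative[OF oV0 s\<tau> x0V0] has_derivative_linear by blast
  obtain w0 where w0: "frame_form A 0 3 x0 w0 = 1" using tangent_and_basis_forms(2)[OF x0] by blast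
  \<comment> \<open>The gradient of \<open>\<tau>\<close> at \<open>x0\<close>; \<open>e\<close> is
    its multiple with \<open>L e = 1\<close>. Cauchy-Schwarz is sharp along \<open>n\<close>, so the
    diameter of the ball in this direction already attains all values of \<open>L\<close> on the
    ball, an interval of half-length \<open>r * norm n\<close>.\<close>
  define n where "n = (\<Sum>b\<in>Basis. L b *\<^sub>R b)"
  have n: "L v = v \<bullet> n" for v
  proof -
    have "L v = L (\<Sum>b\<in>Basis. (v \<bullet> b) *\<^sub>R b)" by (simp add: euclidean_representation)
    also have "\<dots> = (\<Sum>b\<in>Basis. (v \<bullet> b) *\<^sub>R L b)" by (simp only: linear_sum[OF linL] linear_scale[OF linL])
    finally show ?thesis unfolding n_def by (simp add: inner_sum_right mult.commute)
  qed
  have "L w0 \<noteq> 0" unfolding L_def using j by (simp add: \<tau>'[OF x0V0] E0(2) w0)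
  then have n0: "n \<noteq> 0" unfolding n by auto
  define e where "e = n /\<^sub>R (norm n)\<^sup>2"
  have Le: "L e = 1" using n0 unfolding n e_def by (simp add: power2_norm_eq_inner)
  have norm_e: "norm e = inverse (norm n)" using n0 unfolding e_def by (simp add: power2_eq_square)
  \<comment> \<open>Here coordinate \<open>j\<close> of the direction of motion stays nonzero, so
    the derivatives of \<open>\<tau>\<close> and \<open>G\<close> have the same kernel.\<close>
  define V1 where "V1 = {x \<in> V0. frechet_derivative \<tau> (at x) e \<noteq> 0}"
  have V1V0: "V1 \<subseteq> V0" unfolding V1_def by blast
  have s\<tau>': "smooth_on (\<lambda>x. frechet_derivative \<tau> (at x) e) V0" by (rule smooth_on_frechet_derivative[OF s\<tau>])
  have oV1: "open V1"
    using continuous_open_preimage[OF smooth_on_imp_continuous_on[OF s\<tau>'] oV0, of "- {0}"]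
    unfolding V1_def by (simp add: vimage_def Int_def open_Compl)
  have x0V1: "x0 \<in> V1" using x0V0 Le unfolding V1_def L_def by simp
  have ker: "frechet_derivative G (at x) w = 0" if x: "x \<in> V1" and w: "frechet_derivative \<tau> (at x) w = 0" for x w
  proof -
    have x: "x \<in> V0" "frechet_derivative \<tau> (at x) e \<noteq> 0" using x unfolding V1_def by auto
    obtain E1 where "\<And>w. frechet_derivative G (at x) w = frame_form A 0 3 x w *\<^sub>R E1" using E[OF x(1)] by blast
    then show ?thesis using x(2) w by (simp add: \<tau>'[OF x(1)])
  qed
  have R: "linear (\<lambda>t. t *\<^sub>R e)" "\<And>t. L (t *\<^sub>R e) = t"
    by (auto intro!: linearI simp: scaleR_left_distrib linear_scale[OF linL] Le)
  obtain r \<phi> \<phi>' where r: "0 < r" and \<phi>: "\<phi> x0 = x0" "\<phi> ` ball x0 r \<subseteq> V1" "open (\<phi> ` ball x0 r)"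
    and d\<phi>: "\<And>z. z \<in> ball x0 r \<Longrightarrow> (\<phi> has_derivative \<phi>' z) (at z)"
    and \<phi>'1: "\<And>z v. z \<in> ball x0 r \<Longrightarrow> \<phi>' z v + (frechet_derivative \<tau> (at (\<phi> z)) (\<phi>' z v) - L (\<phi>' z v)) *\<^sub>R e = v"
    and \<tau>\<phi>: "\<And>z. z \<in> ball x0 r \<Longrightarrow> \<tau> (\<phi> z) = \<tau> x0 + L (z - x0)"
    and \<phi>'2: "\<And>z v. z \<in> ball x0 r \<Longrightarrow> frechet_derivative \<tau> (at (\<phi> z)) (\<phi>' z v) = L v"
    by (rule submersion_coordinates[OF oV1 x0V1 smooth_on_subset[OF s\<tau> V1V0] L_def R]) blast
  define V where "V = \<phi> ` ball x0 r"
  define I where "I = {t. \<bar>t - \<tau> x0\<bar> < r * norm n}"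
  define c where "c t = x0 + (t - \<tau> x0) *\<^sub>R e" for t
  \<comment> \<open>A transversal meeting each level of \<open>\<tau>\<close> in \<open>V\<close>
    once; \<open>g\<close> is the normalised focus along it.\<close>
  define \<xi> where "\<xi> t = \<phi> (c t)" for t
  define g where "g t = G (\<xi> t)" for t
  have V: "open V" "x0 \<in> V" "V \<subseteq> V1"
    using \<phi> r unfolding V_def by (auto intro: rev_image_eqI[of x0])
  have VU: "V \<subseteq> U" "V \<subseteq> V0" using V(3) V1V0 V0U by auto
  have cI: "c t \<in> ball x0 r" if "t \<in> I" for t
    using that n0 unfolding I_def c_def by (simp add: dist_norm norm_e) (simp add: field_simps)
  have \<xi>V: "\<xi> t \<in> V" if "t \<in> I" for t using cI[OF that] unfolding \<xi>_def V_def by blast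
  have \<tau>\<xi>: "\<tau> (\<xi> t) = t" if "t \<in> I" for t
    unfolding \<xi>_def \<tau>\<phi>[OF cI[OF that]] unfolding c_def by (simp add: R(2))
  have \<tau>I: "\<tau> y \<in> I" if y: "y \<in> V" for y
  proof -
    obtain z where z: "z \<in> ball x0 r" "y = \<phi> z" using y unfolding V_def by blast
    have "\<bar>L (z - x0)\<bar> \<le> norm (z - x0) * norm n" unfolding n by (rule Cauchy_Schwarz_ineq2)
    also have "\<dots> < r * norm n" using z(1) n0 by (simp add: dist_norm norm_minus_commute)
    finally show ?thesis unfolding I_def z(2) \<tau>\<phi>[OF z(1)] by simp
  qed
  have I: "open I" "connected I" "I \<noteq> {}"
  proof -
    have "I = ball (\<tau> x0) (r * norm n)" unfolding I_def by (auto simp: dist_real_def)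
    then show "open I" "connected I" "I \<noteq> {}" using r n0 by (auto simp: mult_le_0_iff)
  qed
  \<comment> \<open>\<open>\<phi>\<close> straightens the levels of \<open>\<tau>\<close> to slices
    of the ball. The preimage of \<open>y\<close> and the point \<open>c (\<tau> y)\<close> lie on
    the same slice, on which \<open>G\<close> is constant.\<close>
  have Gg: "G y = g (\<tau> y)" if y: "y \<in> V" for y
  proof -
    obtain z where z: "z \<in> ball x0 r" "y = \<phi> z" using y unfolding V_def by blast
    have "L z = L (c (\<tau> y))"
      unfolding c_def z(2) \<tau>\<phi>[OF z(1)] by (simp add: linear_add[OF linL] linear_diff[OF linL] R(2))
    moreover have "(G has_derivative frechet_derivative G (at (\<phi> z))) (at (\<phi> z))" if "z \<in> ball x0 r" for z
      using that dG \<phi>(2) V1V0 by blast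
    moreover have "frechet_derivative G (at (\<phi> z)) (\<phi>' z v) = 0" if "z \<in> ball x0 r" "L v = 0" for z v
      using that \<phi>(2) \<phi>'2 by (intro ker) auto
    ultimately show ?thesis
      unfolding g_def \<xi>_def z(2)
      by (intro functional_dependence_coordinates[OF linL d\<phi> _ _ z(1) cI, where F = G and F' = "\<lambda>x. frechet_derivative G (at x)"])
        (use \<tau>I[OF y] z(2) in auto)
  qed
  \<comment> \<open>The velocity of the transversal: by the relation for \<open>\<phi>'\<close> it
    is proportional to \<open>e\<close>, and the factor is fixed by \<open>\<tau>\<close> growing at
    unit speed. The field is smooth even though \<open>\<phi>\<close> is only known to be
    differentiable, which makes \<open>\<xi>\<close> smooth.\<close>
  define X where "X x = inverse (frechet_derivative \<tau> (at x) e) *\<^sub>R e" for x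
  have sX: "smooth_on X V"
    unfolding X_def using smooth_on_subset[OF s\<tau>' VU(2)] V(3)
    by (intro smooth_on_linear[OF V(1) bounded_linear_scaleR_left] smooth_on_inverse V(1)) (auto simp: V1_def)
  have d\<xi>: "(\<xi> has_vector_derivative X (\<xi> t)) (at t)" if t: "t \<in> I" for t
  proof -
    let ?z = "c t" and ?w = "\<phi>' (c t) e"
    note z = cI[OF t]
    have "(c has_derivative (\<lambda>h. h *\<^sub>R e)) (at t)" unfolding c_def by (auto intro!: derivative_eq_intros)
    from has_derivative_compose[OF this d\<phi>[OF z]]
    have "(\<xi> has_derivative (\<lambda>h. \<phi>' (c t) (h *\<^sub>R e))) (at t)" unfolding \<xi>_def .
    moreover have "\<phi>' (c t) (h *\<^sub>R e) = h *\<^sub>R ?w" for h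
      by (rule linear_scale[OF has_derivative_linear[OF d\<phi>[OF z]]])
    ultimately have *: "(\<xi> has_vector_derivative ?w) (at t)" unfolding has_vector_derivative_def by simp
    have xV: "\<phi> (c t) \<in> V0" "frechet_derivative \<tau> (at (\<phi> (c t))) e \<noteq> 0"
      using \<xi>V[OF t] V(3) unfolding V1_def \<xi>_def by auto
    have lin: "linear (frechet_derivative \<tau> (at (\<phi> (c t))))"
      by (rule has_derivative_linear[OF smooth_on_has_derivative[OF oV0 s\<tau> xV(1)]])
    have "?w + (1 - L ?w) *\<^sub>R e = e" using \<phi>'1[OF z, of e] \<phi>'2[OF z, of e] Le by simp
    then have w: "?w = L ?w *\<^sub>R e" by (simp add: algebra_simps)
    have "L ?w * frechet_derivative \<tau> (at (\<phi> (c t))) e = 1"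
      using \<phi>'2[OF z, of e] Le linear_scale[OF lin, of "L ?w" e] w by simp
    then have "L ?w = inverse (frechet_derivative \<tau> (at (\<phi> (c t))) e)"
      using xV(2) by (simp add: field_simps)
    then have "?w = X (\<xi> t)" unfolding X_def \<xi>_def using w by simp
    then show ?thesis using * by simp
  qed
  have s\<xi>: "smooth_on \<xi> I"
    using \<xi>V by (intro smooth_on_ode_solution[OF I(1) V(1) sX _ d\<xi>]) auto
  have sg: "smooth_on g I"
    unfolding g_def using \<xi>V by (intro smooth_on_compose[OF V(1) I(1) smooth_on_subset[OF sG VU(2)] s\<xi>]) auto
  have gk: "g t $ k = 1" and gj: "g t $ j = t" if "t \<in> I" for t
    using Gk \<xi>V[OF that] VU(2) \<tau>\<xi>[OF that] unfolding g_def \<tau>_def by auto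
  \<comment> \<open>Both normalised vectors have coordinate \<open>k\<close> equal to 1, so
    proportional means equal, and coordinate \<open>j\<close> reads off the parameter.\<close>
  have fib: "span {A y $ 1} = span {g t} \<longleftrightarrow> \<tau> y = t" if y: "y \<in> V" and t: "t \<in> I" for y t
  proof
    assume "\<tau> y = t"
    then show "span {A y $ 1} = span {g t}" using spanG Gg[OF y] y VU(2) by auto
  next
    assume "span {A y $ 1} = span {g t}"
    then have "G y \<in> span {g t}" using spanG y VU(2) span_base[of "G y" "{G y}"] by auto
    then obtain s where s: "G y = s *\<^sub>R g t" by (auto simp: span_singleton)
    then have "s = 1" using Gk[of y] y VU(2) gk[OF t] by auto
    then show "\<tau> y = t" using s gj[OF t] unfolding \<tau>_def by simp
  qed
  have \<tau>V: "\<tau> ` V = I"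
  proof
    show "\<tau> ` V \<subseteq> I" using \<tau>I by blast
    show "I \<subseteq> \<tau> ` V" using \<xi>V \<tau>\<xi> by (metis image_eqI subsetI)
  qed
  have curve: "regular_curve g I"
    unfolding regular_curve_def
  proof (intro conjI I sg ballI)
    show "inj_on (\<lambda>t. span {g t}) I"
    proof (rule inj_onI)
      fix s t assume st: "s \<in> I" "t \<in> I" "span {g s} = span {g t}"
      have y: "\<xi> s \<in> V" "\<tau> (\<xi> s) = s" using \<xi>V \<tau>\<xi> st(1) by auto
      then have "span {A (\<xi> s) $ 1} = span {g s}" using fib st(1) by blast
      then show "s = t" using fib[OF y(1) st(2)] st(3) y(2) by simp
    qed
    fix t assume t: "t \<in> I"
    let ?D = "frechet_derivative g (at t)"
    have dg: "(g has_derivative ?D) (at t)" by (rule smooth_on_has_derivative[OF I(1) sg t])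
    have lin: "linear ?D" using dg has_derivative_linear by blast
    have D1: "?D h = h *\<^sub>R ?D 1" for h using linear_scale[OF lin, of h 1] by simp
    \<comment> \<open>Coordinate \<open>j\<close> of \<open>g\<close> is the parameter and
      coordinate \<open>k\<close> is constantly 1; the derivative has entries 1 and 0 there, so it
      is independent of \<open>g t\<close>.\<close>
    have "((\<lambda>s. s) has_derivative (\<lambda>h. ?D h $ j)) (at t)"
      by (rule has_derivative_transform_within_open[OF bounded_linear.has_derivative[OF bounded_linear_vec_nth dg] I(1) t])
        (simp add: gj)
    from fun_cong[OF has_derivative_unique[OF this has_derivative_ident]] have Dj: "?D 1 $ j = 1" by simp
    have "((\<lambda>s. 1::real) has_derivative (\<lambda>h. ?D h $ k)) (at t)"
      by (rule has_derivative_transform_within_open[OF bounded_linear.has_derivative[OF bounded_linear_vec_nth dg] I(1) t])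
        (simp add: gk)
    from fun_cong[OF has_derivative_unique[OF this has_derivative_const]] have Dk: "?D 1 $ k = 0" by simp
    have r: "range ?D = span {?D 1}"
      unfolding span_singleton by (rule image_cong[OF refl D1])
    have "proj_tangent g t = span {g t, ?D 1}"
      unfolding proj_tangent_def r by (simp add: span_span span_insert[of _ "{?D 1}"] span_insert[of _ "span {?D 1}"])
    moreover have "independent {g t, ?D 1}"
    proof -
      have "g t \<noteq> h *\<^sub>R ?D 1" for h
      proof
        assume "g t = h *\<^sub>R ?D 1"
        then have "g t $ k = h * ?D 1 $ k" by simp
        then show False using gk[OF t] Dk by simp
      qed
      then have "g t \<notin> span {?D 1}" unfolding span_singleton by blast
      moreover have "?D 1 \<noteq> 0" using Dj by auto
      ultimately show ?thesis by (simp add: independent_insert)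
    qed
    moreover have "g t \<noteq> ?D 1" using gk[OF t] Dk by auto
    ultimately show "dim (proj_tangent g t) = 2"
      by (simp add: dim_eq_card_independent)
  qed
  have traces: "traces_curve (\<lambda>y. A y $ 1) V g I"
    unfolding traces_curve_def
  proof (intro conjI curve)
    have "span {A y $ 1} = span {g (\<tau> y)}" if "y \<in> V" for y using fib[OF that] \<tau>I[OF that] by blast
    then have "(\<lambda>y. span {A y $ 1}) ` V = (\<lambda>t. span {g t}) ` (\<tau> ` V)" by (simp add: image_image)
    then show "(\<lambda>y. span {A y $ 1}) ` V = (\<lambda>t. span {g t}) ` I" unfolding \<tau>V .
  qed
  have fiber: "fiber_cone (\<lambda>x. A x $ 1) V (g t) = {y \<in> V. \<tau> y = t}" if "t \<in> I" for t
    unfolding fiber_cone_def using fib that by blast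
  have "foliates_into_cones f A V g I"
    unfolding foliates_into_cones_def
  proof (intro conjI exI[of _ \<tau>] ballI)
    show "smooth_on \<tau> V" by (rule smooth_on_subset[OF s\<tau> VU(2)])
    show "\<tau> ` V = I" by fact
    show "\<exists>w. frechet_derivative \<tau> (at y) w \<noteq> 0" if "y \<in> V" for y using that V(3) unfolding V1_def by blast
    show "fiber_cone (\<lambda>x. A x $ 1) V (g t) = {y \<in> V. \<tau> y = t}" if "t \<in> I" for t by (rule fiber[OF that])
    fix t y assume t: "t \<in> I" and "y \<in> fiber_cone (\<lambda>x. A x $ 1) V (g t)"
    then have y: "y \<in> V" "\<tau> y = t" unfolding fiber[OF t] by auto
    have "g t \<in> span {A y $ 1}" using fib[OF y(1) t] y(2) span_base[of "g t" "{g t}"] by auto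
    then show "g t \<in> span {A y $ 0, A y $ 1}" using span_mono[of "{A y $ 1}" "{A y $ 0, A y $ 1}"] by auto
    have d: "(\<tau> has_derivative frechet_derivative \<tau> (at x)) (at x)" if "x \<in> V" for x
      using smooth_on_has_derivative[OF oV0 s\<tau>] that VU(2) by blast
    \<comment> \<open>The derivative of \<open>\<tau>\<close> is a multiple of \<omega>_0^3, so
      \<open>\<tau>\<close> is stationary along the leaves.\<close>
    have ker\<tau>: "frechet_derivative \<tau> (at x) w = 0"
      if "x \<in> V" "frame_form A 0 2 x w = 0" "frame_form A 0 3 x w = 0" for x w
    proof -
      have "x \<in> V0" using that VU by blast
      with E[OF this] that(3) show ?thesis by (auto simp: \<tau>')
    qed
    obtain W where W: "open W" "y \<in> W" "W \<subseteq> V" "\<And>z. z \<in> W \<Longrightarrow> f z \<in> span {A y $ 0, A y $ 1} \<Longrightarrow> \<tau> z = \<tau> y"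
      by (rule constant_on_generator[OF gauss V(1) y(1) VU(1) d ker\<tau>]) (assumption | rule that)+
    then show "\<exists>W. open W \<and> y \<in> W \<and> W \<subseteq> V \<and> {z \<in> W. f z \<in> span {A y $ 0, A y $ 1}} \<subseteq> fiber_cone (\<lambda>x. A x $ 1) V (g t)"
      unfolding fiber[OF t] using y(2) W by (intro exI[of _ W]) auto
  qed
  with traces V(1,2) VU(1) show ?thesis by blast
qed

lemma twisted_cone_if_focal_curve:
  assumes gauss: "has_gauss_rank f U 2"
    and wedge: "\<And>x u v. x \<in> U \<Longrightarrow> wedge (frame_form A 1 0 x) (frame_form A 0 3 x) u v = 0"
  shows "describes_curve (\<lambda>x. A x $ 1) U" "twisted_cone f U"
proof -
  note * = focus_traces_and_foliates[OF gauss wedge]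
  show "describes_curve (\<lambda>x. A x $ 1) U" unfolding describes_curve_def using * by meson
  show "twisted_cone f U"
    unfolding twisted_cone_def using hypersurface gauss adapted * unfolding adapted_frame_def by blast
qed

end

section \<open>A twisted cone\<close>

definition vec5 :: "real \<Rightarrow> real \<Rightarrow> real \<Rightarrow> real \<Rightarrow> real \<Rightarrow> real^5" where
  "vec5 a b c d e = (\<chi> i. if i = 0 then a else if i = 1 then b else if i = 2 then c else if i = 3 then d else e)"

lemma vec5_nth [simp]:
  "vec5 a b c d e $ 0 = a" "vec5 a b c d e $ 1 = b" "vec5 a b c d e $ 2 = c"
  "vec5 a b c d e $ 3 = d" "vec5 a b c d e $ 4 = e"
  by (simp_all add: vec5_def)

lemma vec5_eq_iff: "v = w \<longleftrightarrow> v $ 0 = w $ 0 \<and> v $ 1 = w $ 1 \<and> v $ 2 = w $ 2 \<and> v $ 3 = w $ 3 \<and> v $ 4 = w $ 4"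
  for v w :: "'a^5"
  by (simp add: vec_eq_iff forall_5)

lemma inner_5: "v \<bullet> w = v $ 0 * w $ 0 + v $ 1 * w $ 1 + v $ 2 * w $ 2 + v $ 3 * w $ 3 + v $ 4 * w $ 4"
  for v w :: "real^5"
  by (simp add: inner_vec_def sum_5)

lemma smooth_on_vec:
  fixes f :: "'a::euclidean_space \<Rightarrow> 'b::euclidean_space^'n"
  assumes "open S" "\<And>i. smooth_on (\<lambda>x. f x $ i) S"
  shows "smooth_on f S"
proof (rule smooth_on_componentwise[OF assms(1)])
  fix b :: "'b^'n" assume "b \<in> Basis"
  then obtain i c where "b = axis i c" unfolding Basis_vec_def by blast
  then show "smooth_on (\<lambda>x. f x \<bullet> b) S"
    using smooth_on_linear[OF assms(1) bounded_linear_inner_left assms(2)] by (simp add: inner_axis)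
qed

lemma smooth_on_mult:
  fixes f g :: "'a::euclidean_space \<Rightarrow> real"
  shows "open S \<Longrightarrow> smooth_on f S \<Longrightarrow> smooth_on g S \<Longrightarrow> smooth_on (\<lambda>x. f x * g x) S"
  by (rule smooth_on_bilinear[OF _ bounded_bilinear_mult])

lemma smooth_on_minus: "open S \<Longrightarrow> smooth_on f S \<Longrightarrow> smooth_on (\<lambda>x. - f x) S"
  by (rule smooth_on_linear[OF _ bounded_linear_minus[OF bounded_linear_ident]])

lemma smooth_on_nth: "open S \<Longrightarrow> smooth_on f S \<Longrightarrow> smooth_on (\<lambda>x. f x $ i) S"
  by (rule smooth_on_linear[OF _ bounded_linear_vec_nth])

lemmas smooth_intros = smooth_on_const smooth_on_id smooth_on_add smooth_on_mult smooth_on_minus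
  smooth_on_nth smooth_on_Pair

lemma has_derivative_vec:
  fixes f :: "'a::real_normed_vector \<Rightarrow> 'b::euclidean_space^'n"
  assumes "\<And>i. ((\<lambda>x. f x $ i) has_derivative (\<lambda>v. f' v $ i)) (at x)"
  shows "(f has_derivative f') (at x)"
  unfolding has_derivative_componentwise_within[of f f' x]
proof
  fix b :: "'b^'n" assume "b \<in> Basis"
  then obtain i c where "b = axis i c" unfolding Basis_vec_def by blast
  then show "((\<lambda>x. f x \<bullet> b) has_derivative (\<lambda>x. f' x \<bullet> b)) (at x)"
    using has_derivative_inner_left[OF assms] by (simp add: inner_axis)
qed

text \<open>The focal curve is \<open>g = (1, t, t\<^sup>2/2, 0, 0)\<close>, the cones are the planes spanned by \<open>g\<close>, its
  tangent and \<open>q = (0, 0, 0, 1, t)\<close>, and the rows of the frame are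
  \<open>q + s g' + u g\<close>, \<open>g\<close>, \<open>g'\<close>, \<open>q' + s g''\<close>, \<open>g''\<close>, where \<open>(s, t, u)\<close> are the parameters.\<close>
definition cone_frame :: "real^3 \<Rightarrow> real^5^5" where
  "cone_frame x = (\<chi> i.
     if i = 0 then vec5 (x$3) (x$1 + x$3 * x$2) (x$1 * x$2 + x$3 * (x$2 * x$2) * (1/2)) 1 (x$2)
     else if i = 1 then vec5 1 (x$2) (x$2 * x$2 * (1/2)) 0 0
     else if i = 2 then vec5 0 1 (x$2) 0 0
     else if i = 3 then vec5 0 0 (x$1) 0 1
     else vec5 0 0 1 0 0)"

text \<open>Comes from g''' = 0 and q'' = 0, by which the rows differentiate into one another with
  polynomial coefficients; for instance dA_0 = du A_1 + (ds + u dt) A_2 + dt A_3.\<close>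

definition cone_forms :: "real^3 \<Rightarrow> real^3 \<Rightarrow> real^5^5" where
  "cone_forms x w = (\<chi> i.
     if i = 0 then vec5 0 (w$3) (w$1 + x$3 * w$2) (w$2) 0
     else if i = 1 then vec5 0 0 (w$2) 0 0
     else if i = 2 then vec5 0 0 0 0 (w$2)
     else if i = 3 then vec5 0 0 0 0 (w$1)
     else 0)"

text \<open>The covector that kills g, g', q and q' + s g'' and has value 1 on g''. The parameter u
  does not occur in it, so it is constant along the generators.\<close>

definition cone_conormal :: "real^3 \<Rightarrow> real^5" where
  "cone_conormal x = vec5 (x$2 * x$2 * (1/2)) (- x$2) 1 (x$1 * x$2) (- x$1)"

lemma cone_frame_nth:
  "cone_frame x $ 0 = vec5 (x$3) (x$1 + x$3 * x$2) (x$1 * x$2 + x$3 * (x$2 * x$2) * (1/2)) 1 (x$2)"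
  "cone_frame x $ 1 = vec5 1 (x$2) (x$2 * x$2 * (1/2)) 0 0"
  "cone_frame x $ 2 = vec5 0 1 (x$2) 0 0"
  "cone_frame x $ 3 = vec5 0 0 (x$1) 0 1"
  "cone_frame x $ 4 = vec5 0 0 1 0 0"
  by (simp_all add: cone_frame_def)

lemma cone_forms_nth:
  "cone_forms x w $ 0 = vec5 0 (w$3) (w$1 + x$3 * w$2) (w$2) 0"
  "cone_forms x w $ 1 = vec5 0 0 (w$2) 0 0"
  "cone_forms x w $ 2 = vec5 0 0 0 0 (w$2)"
  "cone_forms x w $ 3 = vec5 0 0 0 0 (w$1)"
  "cone_forms x w $ 4 = 0"
  by (simp_all add: cone_forms_def)

lemma smooth_cone_frame: "smooth_on cone_frame UNIV"
proof (intro smooth_on_vec open_UNIV)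
  fix i j
  show "smooth_on (\<lambda>x. cone_frame x $ i $ j) UNIV"
    using exhaust_5[of i] exhaust_5[of j]
    by (elim disjE; simp only: cone_frame_nth vec5_nth; intro smooth_intros open_UNIV)
qed

lemma smooth_cone_conormal: "smooth_on cone_conormal UNIV"
proof (intro smooth_on_vec open_UNIV)
  fix i
  show "smooth_on (\<lambda>x. cone_conormal x $ i) UNIV"
    using exhaust_5[of i]
    by (elim disjE; simp only: cone_conormal_def vec5_nth; intro smooth_intros open_UNIV)
qed

lemma invertible_cone_frame: "invertible (cone_frame x)"
  unfolding invertible_left_inverse matrix_left_invertible_ker
proof (intro allI impI)
  fix v assume "cone_frame x *v v = 0"
  then have *: "cone_frame x $ i \<bullet> v = 0" for i
    by (metis matrix_vector_mul_component zero_index)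
  show "v = 0"
    using *[of 0] *[of 1] *[of 2] *[of 3] *[of 4] by (simp add: cone_frame_nth inner_5 vec5_eq_iff)
qed

lemma has_derivative_cone_frame:
  "(cone_frame has_derivative (\<lambda>w. cone_forms x w ** cone_frame x)) (at x)"
proof (intro has_derivative_vec)
  fix i j
  have d: "((\<lambda>x. x $ k) has_derivative (\<lambda>w. w $ k)) (at x)" for k :: 3
    by (rule bounded_linear_imp_has_derivative[OF bounded_linear_vec_nth])
  show "((\<lambda>x. cone_frame x $ i $ j) has_derivative (\<lambda>w. (cone_forms x w ** cone_frame x) $ i $ j)) (at x)"
    unfolding matrix_mult_row sum_5
    using exhaust_5[of i] exhaust_5[of j]
    by (elim disjE; simp only: cone_frame_nth cone_forms_nth vec5_nth vector_add_component vector_scaleR_component zero_index;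
        auto intro!: derivative_eq_intros d simp: algebra_simps)
qed

lemma frame_form_cone_frame: "frame_form cone_frame i j x w = cone_forms x w $ i $ j"
  unfolding frame_form_def frechet_derivative_at[OF has_derivative_cone_frame, symmetric]
  by (simp add: matrix_inv_mult(1)[OF invertible_cone_frame] flip: matrix_mul_assoc)

section \<open>The example as a hypersurface of Gauss rank two\<close>

definition cone_point_map :: "real^3 \<Rightarrow> real^5" where
  "cone_point_map x = cone_frame x $ 0"

lemma smooth_cone_point_map: "smooth_on cone_point_map UNIV"
  unfolding cone_point_map_def by (rule smooth_on_nth[OF open_UNIV smooth_cone_frame])

lemma has_derivative_cone_point_map:
  "(cone_point_map has_derivative (\<lambda>w. w$3 *\<^sub>R cone_frame x $ 1 + (w$1 + x$3 * w$2) *\<^sub>R cone_frame x $ 2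
     + w$2 *\<^sub>R cone_frame x $ 3)) (at x)"
proof -
  have "(cone_point_map has_derivative (\<lambda>w. (cone_forms x w ** cone_frame x) $ 0)) (at x)"
    unfolding cone_point_map_def
    by (rule bounded_linear.has_derivative[OF bounded_linear_vec_nth has_derivative_cone_frame])
  then show ?thesis by (simp add: matrix_mult_row sum_5 cone_forms_nth)
qed

lemma proj_tangent_eq_range:
  assumes "(f has_derivative D) (at x)"
  shows "proj_tangent f x = range (\<lambda>(c, w). c *\<^sub>R f x + D w)"
  unfolding proj_tangent_def frechet_derivative_at[OF assms, symmetric]
    span_insert_range_linear[OF has_derivative_linear[OF assms]] by auto

lemma dim_proj_tangent_cone_point_map: "dim (proj_tangent cone_point_map x) = 4"
proof -
  let ?D = "\<lambda>w::real^3. w$3 *\<^sub>R cone_frame x $ 1 + (w$1 + x$3 * w$2) *\<^sub>R cone_frame x $ 2 + w$2 *\<^sub>R cone_frame x $ 3"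
  let ?h = "\<lambda>(c, w). c *\<^sub>R cone_point_map x + ?D w"
  have "linear ?h" by (rule linearI) (auto simp: algebra_simps)
  moreover have "inj ?h"
  proof (rule linear_injective_0[THEN iffD2, OF \<open>linear ?h\<close>], intro allI impI)
    fix p :: "real \<times> (real^3)"
    assume "?h p = 0"
    then show "p = 0"
      by (cases p) (auto simp: cone_point_map_def cone_frame_nth vec5_eq_iff vec_eq_iff forall_3 zero_prod_def)
  qed
  ultimately have "dim (range ?h) = dim (UNIV :: (real \<times> (real^3)) set)"
    by (intro dim_image_eq) (simp_all add: inj_on_subset)
  then show ?thesis
    unfolding proj_tangent_eq_range[OF has_derivative_cone_point_map] by (simp add: dim_UNIV)
qed

lemma proj_tangent_cone_point_map: "proj_tangent cone_point_map x = {w. cone_conormal x \<bullet> w = 0}"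
proof (rule subspace_dim_equal)
  show "subspace (proj_tangent cone_point_map x)" unfolding proj_tangent_def by simp
  show "subspace {w. cone_conormal x \<bullet> w = 0}" by (rule subspace_hyperplane)
  show "proj_tangent cone_point_map x \<subseteq> {w. cone_conormal x \<bullet> w = 0}"
    unfolding proj_tangent_eq_range[OF has_derivative_cone_point_map]
    by (auto simp: cone_conormal_def cone_point_map_def cone_frame_nth inner_5 field_simps)
  have "cone_conormal x \<noteq> 0" by (simp add: cone_conormal_def vec5_eq_iff)
  then show "dim {w. cone_conormal x \<bullet> w = 0} \<le> dim (proj_tangent cone_point_map x)"
    by (simp add: dim_hyperplane dim_proj_tangent_cone_point_map)
qed

lemma hypersurface_cone_point_map: "hypersurface cone_point_map UNIV"
  unfolding hypersurface_def
proof (intro conjI ballI open_UNIV smooth_cone_point_map dim_proj_tangent_cone_point_map)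
  show "inj (\<lambda>x. span {cone_point_map x})"
  proof (rule injI)
    fix x y assume "span {cone_point_map x} = span {cone_point_map y}"
    then have "cone_point_map x \<in> span {cone_point_map y}" by (metis span_base singletonI)
    then obtain c where "cone_point_map x = c *\<^sub>R cone_point_map y" by (auto simp: span_singleton)
    then show "x = y" by (auto simp: cone_point_map_def cone_frame_nth vec5_eq_iff vec_eq_iff forall_3)
  qed
qed simp

lemma has_derivative_cone_conormal:
  "(cone_conormal has_derivative (\<lambda>w. vec5 (x$2 * w$2) (- w$2) 0 (x$1 * w$2 + w$1 * x$2) (- w$1))) (at x)"
proof (rule has_derivative_vec)
  fix i
  have d: "((\<lambda>x. x $ k) has_derivative (\<lambda>w. w $ k)) (at x)" for k :: 3
    by (rule bounded_linear_imp_has_derivative[OF bounded_linear_vec_nth])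
  show "((\<lambda>x. cone_conormal x $ i) has_derivative
      (\<lambda>w. vec5 (x$2 * w$2) (- w$2) 0 (x$1 * w$2 + w$1 * x$2) (- w$1) $ i)) (at x)"
    using exhaust_5[of i]
    by (elim disjE; simp only: cone_conormal_def vec5_nth; auto intro!: derivative_eq_intros d simp: algebra_simps)
qed

lemma has_gauss_rank_cone_point_map: "has_gauss_rank cone_point_map UNIV 2"
  unfolding has_gauss_rank_def
proof (intro exI[of _ cone_conormal] conjI ballI smooth_cone_conormal)
  fix x
  show "cone_conormal x \<noteq> 0" by (simp add: cone_conormal_def vec5_eq_iff)
  show "cone_conormal x \<bullet> w = 0" if "w \<in> proj_tangent cone_point_map x" for w
    using that unfolding proj_tangent_cone_point_map by simp
  \<comment> \<open>The derivative of the conormal ignores the third coordinate of \<open>w\<close>.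
    Parametrising by the remaining three numbers gives an injective map, hence dimension 3.\<close>
  let ?h = "\<lambda>(c, a, b). c *\<^sub>R cone_conormal x + vec5 (x$2 * b) (- b) 0 (x$1 * b + a * x$2) (- a)"
  have "proj_tangent cone_conormal x = range ?h" (is "_ = ?R")
  proof
    show "proj_tangent cone_conormal x \<subseteq> ?R"
    proof
      fix v assume "v \<in> proj_tangent cone_conormal x"
      then obtain c and w :: "real^3" where v: "v = c *\<^sub>R cone_conormal x
          + vec5 (x$2 * w$2) (- w$2) 0 (x$1 * w$2 + w$1 * x$2) (- w$1)"
        unfolding proj_tangent_eq_range[OF has_derivative_cone_conormal] by auto
      show "v \<in> ?R" unfolding v by (rule image_eqI[of _ _ "(c, w$1, w$2)"]) simp_all
    qed
    show "?R \<subseteq> proj_tangent cone_conormal x"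
    proof
      fix v assume "v \<in> ?R"
      then obtain c a b where v: "v = ?h (c, a, b)" by auto
      show "v \<in> proj_tangent cone_conormal x"
        unfolding proj_tangent_eq_range[OF has_derivative_cone_conormal] v
        by (rule image_eqI[of _ _ "(c, vector [a, b, 0])"]) simp_all
    qed
  qed
  moreover have lin: "linear ?h"
    by (rule linearI) (auto simp: vec5_eq_iff algebra_simps)
  moreover have "inj ?h"
  proof (rule linear_injective_0[THEN iffD2, OF lin], intro allI impI)
    fix p :: "real \<times> real \<times> real"
    assume "?h p = 0"
    then show "p = 0"
      by (cases p) (auto simp: cone_conormal_def vec5_eq_iff zero_prod_def)
  qed
  then have "dim (range ?h) = dim (UNIV :: (real \<times> real \<times> real) set)"
    using lin by (intro dim_image_eq) (simp_all add: inj_on_subset)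
  ultimately show "dim (proj_tangent cone_conormal x) = 2 + 1" by (simp add: dim_UNIV)
qed

lemma generator_cone_point_map:
  "generator cone_point_map UNIV x (span {cone_frame x $ 0, cone_frame x $ 1})"
  unfolding generator_def
proof (intro conjI exI[of _ UNIV])
  have "independent {cone_frame x $ 0, cone_frame x $ 1}"
    by (auto simp: independent_insert span_singleton cone_frame_nth vec5_eq_iff)
  moreover have "cone_frame x $ 0 \<noteq> cone_frame x $ 1" by (simp add: cone_frame_nth vec5_eq_iff)
  ultimately show "dim (span {cone_frame x $ 0, cone_frame x $ 1}) = 2"
    by (simp add: dim_eq_card_independent)
  have "proj_tangent cone_point_map y = proj_tangent cone_point_map x \<longleftrightarrow> y$1 = x$1 \<and> y$2 = x$2" for y
  proof
    assume *: "proj_tangent cone_point_map y = proj_tangent cone_point_map x"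
    have "cone_frame y $ i \<in> {w. cone_conormal y \<bullet> w = 0}" if "i \<in> {1, 3}" for i
      using that by (auto simp: cone_conormal_def cone_frame_nth inner_5)
    then have "cone_conormal x \<bullet> cone_frame y $ 1 = 0" "cone_conormal x \<bullet> cone_frame y $ 3 = 0"
      using * unfolding proj_tangent_cone_point_map by blast+
    \<comment> \<open>The conormal at \<open>x\<close> has the value
      \<open>(x$2 - y$2)\<^sup>2 / 2\<close> on the focus at \<open>y\<close> and
      \<open>y$1 - x$1\<close> on the row 3 there, so it separates generators.\<close>
    then have "(x$2 - y$2)\<^sup>2 = 0" "y$1 = x$1"
      by (simp_all add: cone_conormal_def cone_frame_nth inner_5 power2_eq_square field_simps)
    then show "y$1 = x$1 \<and> y$2 = x$2" by simp
  next
    assume "y$1 = x$1 \<and> y$2 = x$2"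
    then show "proj_tangent cone_point_map y = proj_tangent cone_point_map x"
      unfolding proj_tangent_cone_point_map cone_conormal_def by simp
  qed
  moreover have "cone_point_map y \<in> span {cone_frame x $ 0, cone_frame x $ 1} \<longleftrightarrow> y$1 = x$1 \<and> y$2 = x$2" for y
  proof
    assume "cone_point_map y \<in> span {cone_frame x $ 0, cone_frame x $ 1}"
    then obtain a b where "cone_point_map y = a *\<^sub>R cone_frame x $ 0 + b *\<^sub>R cone_frame x $ 1"
      by (auto simp: span_insert span_singleton algebra_simps)
    then have "a = 1" "y$2 = x$2" "y$3 = x$3 + b" "y$1 + y$3 * y$2 = x$1 + x$3 * x$2 + b * x$2"
      by (auto simp: cone_point_map_def cone_frame_nth vec5_eq_iff)
    then show "y$1 = x$1 \<and> y$2 = x$2" by (simp add: algebra_simps)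
  next
    assume "y$1 = x$1 \<and> y$2 = x$2"
    then have "cone_point_map y = cone_frame x $ 0 + (y$3 - x$3) *\<^sub>R cone_frame x $ 1"
      by (simp add: cone_point_map_def cone_frame_nth vec5_eq_iff algebra_simps)
    then show "cone_point_map y \<in> span {cone_frame x $ 0, cone_frame x $ 1}"
      by (simp add: span_add span_base span_scale)
  qed
  ultimately show "{y \<in> UNIV. proj_tangent cone_point_map y = proj_tangent cone_point_map x}
      = {y \<in> UNIV. cone_point_map y \<in> span {cone_frame x $ 0, cone_frame x $ 1}}" by simp
qed simp_all

lemma adapted_cone_frame: "adapted_frame cone_point_map UNIV cone_frame"
proof -
  have "frame_field cone_point_map UNIV cone_frame"
    unfolding frame_field_def
    by (intro conjI ballI smooth_cone_frame invertible_cone_frame generator_cone_point_map)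
      (simp_all add: cone_point_map_def[symmetric] proj_tangent_cone_point_map cone_conormal_def inner_5,
        simp_all add: cone_point_map_def cone_frame_nth)
  moreover
  \<comment> \<open>Read off from \<omega>_2^4 = \<omega>_0^3, \<omega>_3^4 = ds = \<omega>_0^2 - u
    \<omega>_0^3, \<omega>_1^2 = \<omega>_0^3 and \<omega>_1^3 = 0.\<close>
  define B :: "real^3 \<Rightarrow> real^2^2" where "B x = (\<chi> i j. if i = 1 then (if j = 1 then 0 else 1) else (if j = 1 then 1 else - x$3))" for x
  define C :: "real^3 \<Rightarrow> real^2^2" where "C x = (\<chi> i j. if i = 1 \<and> j = 2 then 1 else 0)" for x
  have B: "B x $ 1 $ 1 = 0" "B x $ 1 $ 2 = 1" "B x $ 2 $ 1 = 1" "B x $ 2 $ 2 = - x$3" for x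
    unfolding B_def by simp_all
  have C: "C x $ 1 $ 1 = 0" "C x $ 1 $ 2 = 1" "C x $ 2 $ 1 = 0" "C x $ 2 $ 2 = 0" for x
    unfolding C_def by simp_all
  have "frame_coeffs UNIV cone_frame B C"
    unfolding frame_coeffs_def
  proof (intro ballI conjI allI)
    fix x
    show "invertible (B x)" by (simp add: invertible_det_nz det_2 B)
    show "transpose (B x) = B x" by (simp add: vec_eq_iff forall_2 transpose_def B)
    show "transpose (B x ** C x) = B x ** C x"
      by (simp add: vec_eq_iff forall_2 transpose_def matrix_matrix_mult_def sum_2 B C)
    fix w
    show "frame_form cone_frame 0 4 x w = 0" "frame_form cone_frame 1 4 x w = 0"
      by (simp_all add: frame_form_cone_frame cone_forms_nth)
    fix p :: 2
    show "frame_form cone_frame (pidx p) 4 x w = (\<Sum>q\<in>UNIV. B x $ p $ q * frame_form cone_frame 0 (pidx q) x w)"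
      "frame_form cone_frame 1 (pidx p) x w = (\<Sum>q\<in>UNIV. C x $ p $ q * frame_form cone_frame 0 (pidx q) x w)"
      using exhaust_2[of p]
      by (auto simp: frame_form_cone_frame cone_forms_nth sum_2 pidx_def B C)
  qed
  moreover have "double_focus (C x) 0 1 \<and> C x \<noteq> 0" for x
  proof
    have "focal_form (C x) x0 x1 = 1 * (1 * x0 - 0 * x1)\<^sup>2" for x0 x1
      by (simp add: focal_form_def det_2 mat_def C power2_eq_square)
    then show "double_focus (C x) 0 1" unfolding double_focus_def by (intro conjI exI[of _ 1]) auto
    show "C x \<noteq> 0" using C(2)[of x] by auto
  qed
  ultimately have "double_focus_frame cone_point_map UNIV cone_frame"
    unfolding double_focus_frame_def by blast
  then show ?thesis
    unfolding adapted_frame_def Let_def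
    by (intro conjI exI[of _ "\<lambda>_. 1"] exI[of _ "\<lambda>x. - x$3"])
      (simp_all add: frame_form_cone_frame cone_forms_nth)
qed

lemma twisted_cone_cone_point_map: "twisted_cone cone_point_map UNIV"
proof -
  interpret adapted_hypersurface cone_point_map UNIV cone_frame
    by unfold_locales (rule hypersurface_cone_point_map adapted_cone_frame)+
  show ?thesis
    by (rule twisted_cone_if_focal_curve[OF has_gauss_rank_cone_point_map])
      (simp add: wedge_def frame_form_cone_frame cone_forms_nth)
qed

text \<open>The last two functions are zero because \<omega>_1^0 and \<omega>_2^3 vanish in this
  frame; the others are the coefficients of \<omega>_2^4, \<omega>_3^4 and \<omega>_1^2.\<close>

definition cone_solution :: "real^3 \<Rightarrow> cone_point" where
  "cone_solution x = (cone_frame x, 1, - x$3, 1, 0, 0)"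

lemma frame_form_fst: "frame_form fst u v p w = (fst w ** matrix_inv (fst p)) $ u $ v"
  unfolding frame_form_def
  by (subst frechet_derivative_at[OF bounded_linear_imp_has_derivative[OF bounded_linear_fst], symmetric]) simp

lemma solves_system_cone_solution: "solves_system cone_system cone_basis cone_domain cone_solution UNIV"
proof -
  have smooth: "smooth_on cone_solution UNIV"
    unfolding cone_solution_def by (intro smooth_intros open_UNIV smooth_cone_frame)
  have "(cone_solution has_derivative (\<lambda>w. (cone_forms x w ** cone_frame x, 0, - w$3, 0, 0, 0))) (at x)" for x
    unfolding cone_solution_def
    by (intro has_derivative_Pair has_derivative_cone_frame has_derivative_const has_derivative_minus
        bounded_linear_imp_has_derivative bounded_linear_vec_nth)
  note d = frechet_derivative_at[OF this, symmetric]
  have form: "frame_form fst u v (cone_solution x) (cone_forms x w ** cone_frame x, 0, - w$3, 0, 0, 0) = cone_forms x w $ u $ v"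
    for u v x w
    by (simp add: frame_form_fst cone_solution_def matrix_inv_mult(1)[OF invertible_cone_frame] flip: matrix_mul_assoc)
  show ?thesis
    unfolding solves_system_def
  proof (intro conjI ballI allI open_UNIV smooth)
    show "cone_solution ` UNIV \<subseteq> cone_domain"
      by (auto simp: cone_solution_def cone_domain_def invertible_cone_frame)
    fix x
    show "cone_system (cone_solution x) (frechet_derivative cone_solution (at x) w) = 0" for w
      unfolding d cone_system_def Let_def form by (simp add: cone_solution_def cone_forms_nth zero_prod_def)
    \<comment> \<open>The vector solves ds + u dt = \<open>fst p\<close>, dt = \<open>snd p\<close>;
      the third coordinate runs along the generator, where the basis forms vanish.\<close>
    have basis: "p = cone_basis (cone_solution x) (frechet_derivative cone_solution (at x) (vector [fst p - x$3 * snd p, snd p, 0]))" for p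
      unfolding d cone_basis_def form by (simp add: cone_forms_nth)
    show "range (\<lambda>w. cone_basis (cone_solution x) (frechet_derivative cone_solution (at x) w)) = UNIV"
      by (rule surjI, rule basis[symmetric])
  qed simp
qed

section \<open>The system in involution\<close>

lemma differentiable_prod_real:
  fixes f :: "'i \<Rightarrow> 'a::real_normed_vector \<Rightarrow> real"
  assumes "\<And>i. i \<in> I \<Longrightarrow> f i differentiable (at x)"
  shows "(\<lambda>x. \<Prod>i\<in>I. f i x) differentiable (at x)"
  using assms by (induction I rule: infinite_finite_induct) auto

lemma differentiable_det:
  fixes M :: "'a::real_normed_vector \<Rightarrow> real^'n^'n"
  assumes "\<And>i j. (\<lambda>x. M x $ i $ j) differentiable (at x)"
  shows "(\<lambda>x. det (M x)) differentiable (at x)"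
proof -
  have "(\<lambda>x. of_int (sign p) * (\<Prod>i\<in>UNIV. M x $ i $ p i)) differentiable (at x)" for p
    using assms by (intro differentiable_mult differentiable_const differentiable_prod_real)
  then show ?thesis unfolding det_def by (intro differentiable_sum) auto
qed

lemma has_derivative_entry: "((\<lambda>X :: real^'n^'m. X $ i $ j) has_derivative (\<lambda>h. h $ i $ j)) (at A)"
  by (rule bounded_linear.has_derivative[OF bounded_linear_vec_nth bounded_linear_imp_has_derivative[OF bounded_linear_vec_nth]])

lemma differentiable_entry: "(\<lambda>X :: real^'n^'m. X $ i $ j) differentiable (at A)"
  unfolding differentiable_def using has_derivative_entry by blast

text \<open>Cramer's rule writes the entries as quotients of determinants, hence they are
  differentiable; the formula then follows by differentiating the product of a matrix and its
  inverse.\<close>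

lemma has_derivative_matrix_inv:
  fixes A :: "real^'n^'n"
  assumes "invertible A"
  shows "(matrix_inv has_derivative (\<lambda>h. - (matrix_inv A ** h ** matrix_inv A))) (at A)"
proof -
  let ?I = "matrix_inv :: real^'n^'n \<Rightarrow> real^'n^'n"
  let ?c = "\<lambda>X k l. det (\<chi> i j. if j = k then axis l 1 $ i else X $ i $ j) / det X :: real"
  have ent: "?I X $ k $ l = ?c X k l" if "det X \<noteq> 0" for X :: "real^'n^'n" and k l
  proof -
    have "X *v column l (?I X) = axis l 1"
      using matrix_inv_mult(1)[of X] that
      by (simp add: invertible_det_nz matrix_vector_mul_component vec_eq_iff matrix_matrix_mult_def
          matrix_vector_mult_def column_def mat_def axis_def)
    then have "column l (?I X) = (\<chi> k. ?c X k l)" using cramer[OF that] by blast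
    then show ?thesis by (simp add: column_def vec_eq_iff)
  qed
  have dA: "det A \<noteq> 0" using assms by (simp add: invertible_det_nz)
  have dc: "(\<lambda>X. ?c X k l) differentiable (at A)" for k l
  proof (intro differentiable_divide differentiable_det dA)
    fix i j
    show "(\<lambda>X. (\<chi> i j. if j = k then axis l 1 $ i else X $ i $ j) $ i $ j) differentiable (at A)"
      by (cases "j = k") (simp_all add: differentiable_entry)
  qed (rule differentiable_entry)
  \<comment> \<open>\<open>matrix_inv\<close> is governed by these identities on invertible matrices
    only, so they are transferred on an open set of such matrices.\<close>
  have "(\<lambda>X. det X) differentiable (at A)" by (rule differentiable_det[OF differentiable_entry])
  then have "isCont det A" by (simp add: differentiable_imp_continuous_within)
  then have "\<forall>\<^sub>F X in at A. det X \<in> - {0}"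
    using dA by (intro topological_tendstoD[of det "det A"]) (auto simp: isCont_def)
  then obtain S where S: "open S" "A \<in> S" "\<And>X. X \<in> S \<Longrightarrow> det X \<noteq> 0"
    using dA unfolding eventually_at_topological by fastforce
  have "\<exists>D. ((\<lambda>X. ?I X $ k $ l) has_derivative D) (at A)" for k l
  proof -
    obtain D where "((\<lambda>X. ?c X k l) has_derivative D) (at A)"
      using dc[of k l] unfolding differentiable_def by blast
    then have "((\<lambda>X. ?I X $ k $ l) has_derivative D) (at A)"
      by (rule has_derivative_transform_within_open[OF _ S(1,2)]) (rule ent[OF S(3), symmetric])
    then show ?thesis by blast
  qed
  then obtain D where D: "\<And>k l. ((\<lambda>X. ?I X $ k $ l) has_derivative D k l) (at A)" by metis
  define M :: "real^'n^'n \<Rightarrow> real^'n^'n" where "M h = (\<chi> k l. D k l h)" for h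
  have AM: "h ** ?I A + A ** M h = 0" for h
  proof -
    have "(h ** ?I A + A ** M h) $ i $ j = 0" for i j
    proof -
      have "((\<lambda>X. (X ** ?I X) $ i $ j) has_derivative (\<lambda>h. \<Sum>k\<in>UNIV. A $ i $ k * D k j h + h $ i $ k * ?I A $ k $ j)) (at A)"
        unfolding matrix_matrix_mult_def by simp (intro has_derivative_sum has_derivative_mult has_derivative_entry D)
      moreover have "((\<lambda>X. (X ** ?I X) $ i $ j) has_derivative (\<lambda>h. 0)) (at A)"
        by (rule has_derivative_transform_within_open[OF has_derivative_const[of "mat 1 $ i $ j"] S(1,2)])
          (simp add: matrix_inv_mult invertible_det_nz S(3))
      ultimately have "(\<Sum>k\<in>UNIV. A $ i $ k * D k j h + h $ i $ k * ?I A $ k $ j) = 0"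
        by (intro fun_cong[OF has_derivative_unique])
      then show ?thesis by (simp add: matrix_matrix_mult_def M_def sum.distrib)
    qed
    then show ?thesis by (simp add: vec_eq_iff)
  qed
  have "A ** M h = - (h ** ?I A)" for h using AM[of h] by (simp only: add_eq_0_iff)
  then have "?I A ** (A ** M h) = ?I A ** (- (h ** ?I A))" for h by simp
  moreover have "X ** (- Y) = - (X ** Y)" for X Y :: "real^'n^'n"
    by (simp add: matrix_matrix_mult_def vec_eq_iff sum_negf)
  ultimately have "M h = - (?I A ** h ** ?I A)" for h
    by (simp add: matrix_mul_assoc matrix_inv_mult(2)[OF assms])
  moreover have "(?I has_derivative M) (at A)"
    by (intro has_derivative_vec) (simp add: M_def D)
  ultimately show ?thesis by presburger
qed

text \<open>A right inverse of \<open>f\<close> with values in \<open>V\<close> identifies the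
  preimage with the kernel times \<open>T\<close>. It yields both the number of occurring forms and
  the dimension of the space of integral elements.\<close>

lemma dim_linear_preimage:
  fixes f :: "'a::euclidean_space \<Rightarrow> 'b::euclidean_space"
  assumes f: "linear f" and V: "subspace V" and T: "subspace T" "T \<subseteq> f ` V"
  shows "dim {w \<in> V. f w \<in> T} = dim {w \<in> V. f w = 0} + dim T"
proof -
  obtain g where g: "range g \<subseteq> V" "linear g" "\<And>t. t \<in> f ` V \<Longrightarrow> f (g t) = t"
    using linear_exists_right_inverse_on[OF f V] by blast
  have gV: "g t \<in> V" for t using g(1) by blast
  let ?K = "{w \<in> V. f w = 0}" and ?h = "\<lambda>(k, t). k + g t"
  have K: "subspace ?K"
    using V f by (auto simp: subspace_def linear_0 linear_add linear_scale)
  have KT: "subspace (?K \<times> T)" using K T(1) by (rule subspace_Times)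
  have lin: "linear ?h"
    using g(2) by (auto intro!: linearI simp: linear_add[OF g(2)] linear_scale[OF g(2)] algebra_simps)
  have fh: "f (k + g t) = t" if "k \<in> ?K" "t \<in> T" for k t
    using that g(3) T(2) by (auto simp: linear_add[OF f])
  have "inj_on ?h (?K \<times> T)"
  proof (rule inj_onI)
    fix x y assume "x \<in> ?K \<times> T" "y \<in> ?K \<times> T" "?h x = ?h y"
    then show "x = y" using fh[of "fst x" "snd x"] fh[of "fst y" "snd y"] by (auto simp: prod_eq_iff)
  qed
  then have "dim (?h ` (?K \<times> T)) = dim (?K \<times> T)"
    by (intro dim_image_eq lin) (simp only: span_eq_iff[THEN iffD2, OF KT])
  moreover have "?h ` (?K \<times> T) = {w \<in> V. f w \<in> T}"
  proof
    show "?h ` (?K \<times> T) \<subseteq> {w \<in> V. f w \<in> T}"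
      using fh gV V by (auto intro!: subspace_add)
    show "{w \<in> V. f w \<in> T} \<subseteq> ?h ` (?K \<times> T)"
    proof
      fix w assume w: "w \<in> {w \<in> V. f w \<in> T}"
      have "w - g (f w) \<in> ?K"
        using w g(3) gV V by (auto simp: linear_diff[OF f] intro!: subspace_diff)
      then show "w \<in> ?h ` (?K \<times> T)" using w by (intro image_eqI[of _ _ "(w - g (f w), f w)"]) auto
    qed
  qed
  ultimately show ?thesis using K T(1) by (simp add: dim_Times)
qed


section \<open>The structure equations modulo the system\<close>

type_synonym real7 = "real \<times> real \<times> real \<times> real \<times> real \<times> real \<times> real"

text \<open>On \<open>integral_vectors\<close> the quadratic equations become
  \<open>\<alpha>\<^sub>1 \<and> \<omega>\<^sup>3 = 0\<close>, \<open>\<alpha>\<^sub>1 \<and> \<omega>\<^sup>2 + \<alpha>\<^sub>2 \<and> \<omega>\<^sup>3 = 0\<close>, \<open>\<alpha>\<^sub>3 \<and> \<omega>\<^sup>3 = 0\<close>,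
  \<open>\<alpha>\<^sub>4 \<and> \<omega>\<^sup>3 = 0\<close>, \<open>\<alpha>\<^sub>5 \<and> \<omega>\<^sup>3 = 0\<close>, where \<open>\<omega>\<^sup>2, \<omega>\<^sup>3\<close> are the basis forms;
  \<open>cone_coframe\<close> lists \<open>\<omega>\<^sup>2, \<omega>\<^sup>3, \<alpha>\<^sub>1, \<dots>, \<alpha>\<^sub>5\<close>.\<close>
definition cone_coframe :: "cone_point \<Rightarrow> cone_point \<Rightarrow> real7" where
  "cone_coframe p w = (case (p, w) of ((A, b23, b33, c, a, b), (_, db23, db33, dc, da, db)) \<Rightarrow>
     let \<omega> = (\<lambda>u v. frame_form fst u v p w); \<kappa> = \<omega> 0 0 + b * \<omega> 0 2 - \<omega> 3 3 in
     (\<omega> 0 2, \<omega> 0 3,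
      - db23 + b23 * (\<omega> 2 2 - \<omega> 4 4) - b * b23 * \<omega> 0 2 - b23 * \<kappa>,
      - db33 + b23 * \<omega> 3 2 + b33 * (\<omega> 3 3 - \<omega> 4 4) - b23 * (c * \<omega> 0 1 - \<omega> 3 2) - b33 * \<kappa>,
      - dc - a * \<omega> 0 2 + c * (\<omega> 1 1 - \<omega> 2 2) - c * \<kappa>,
      - da + a * (\<omega> 1 1 - \<omega> 0 0) - c * \<omega> 2 0 - a * \<kappa>,
      - db + \<omega> 2 0 + b * (\<omega> 2 2 - \<omega> 3 3) - b23 * \<omega> 4 3 - b * \<kappa>))"

text \<open>The zero slots belong to \<omega>_0^4, \<omega>_1^4 and \<omega>_1^3, whose exterior
  derivatives vanish modulo the system. \<alpha>_1 occurs twice because \<open>b23\<close> is also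
  the coefficient of \<omega>_0^2 in \<omega>_3^4.\<close>

definition cone_quadratic :: "real7 \<Rightarrow> real7 \<Rightarrow> real \<times> real \<times> real \<times> real \<times> real \<times> real \<times> real \<times> real" where
  "cone_quadratic = (\<lambda>(x2, x3, x\<^sub>1, x\<^sub>2, x\<^sub>3, x\<^sub>4, x\<^sub>5) (y2, y3, y\<^sub>1, y\<^sub>2, y\<^sub>3, y\<^sub>4, y\<^sub>5).
     (0, 0, x\<^sub>1 * y3 - y\<^sub>1 * x3, (x\<^sub>1 * y2 - y\<^sub>1 * x2) + (x\<^sub>2 * y3 - y\<^sub>2 * x3), x\<^sub>3 * y3 - y\<^sub>3 * x3, 0,
      x\<^sub>4 * y3 - y\<^sub>4 * x3, x\<^sub>5 * y3 - y\<^sub>5 * x3))"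

text \<open>The base point enters only through the inverse of the frame. Antisymmetrised in
  \<open>u\<close> and \<open>v\<close>, this is the structure equation for d\<omega>_i^j.\<close>

lemma has_derivative_frame_form_fst:
  assumes "invertible (fst p)"
  shows "((\<lambda>q. frame_form fst i j q v) has_derivative
    (\<lambda>u. - (\<Sum>k\<in>UNIV. frame_form fst i k p v * frame_form fst k j p u))) (at p)"
proof -
  let ?I = "matrix_inv (fst p)"
  have "((\<lambda>q. matrix_inv (fst q)) has_derivative (\<lambda>u. - (?I ** fst u ** ?I))) (at p)"
    using has_derivative_compose[OF bounded_linear_imp_has_derivative[OF bounded_linear_fst]
        has_derivative_matrix_inv[OF assms]] .
  from has_derivative_compose[OF this has_derivative_entry]
  have "((\<lambda>q. matrix_inv (fst q) $ k $ j) has_derivative (\<lambda>u. (- (?I ** fst u ** ?I)) $ k $ j)) (at p)" for k .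
  then have "((\<lambda>q. (fst v ** matrix_inv (fst q)) $ i $ j) has_derivative
      (\<lambda>u. \<Sum>k\<in>UNIV. fst v $ i $ k * (- (?I ** fst u ** ?I)) $ k $ j)) (at p)"
    unfolding matrix_matrix_mult_def[of "fst v"] vec_lambda_beta by (intro has_derivative_sum has_derivative_mult_right)
  moreover have "(\<Sum>k\<in>UNIV. fst v $ i $ k * (- (?I ** fst u ** ?I)) $ k $ j)
      = - (\<Sum>k\<in>UNIV. frame_form fst i k p v * frame_form fst k j p u)" for u
  proof -
    have "(\<Sum>k\<in>UNIV. fst v $ i $ k * (?I ** fst u ** ?I) $ k $ j) = (fst v ** (?I ** fst u ** ?I)) $ i $ j"
      by (simp add: matrix_matrix_mult_def)
    also have "\<dots> = ((fst v ** ?I) ** (fst u ** ?I)) $ i $ j" by (simp only: matrix_mul_assoc)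
    finally show ?thesis by (simp add: frame_form_fst sum_negf) (simp add: matrix_matrix_mult_def)
  qed
  ultimately show ?thesis unfolding frame_form_fst by simp
qed

text \<open>Projections in place of the case distinction make the dependence on \<open>p\<close>
  differentiable term by term.\<close>

lemma cone_system_eq:
  "cone_system p w = (frame_form fst 0 4 p w, frame_form fst 1 4 p w,
     frame_form fst 2 4 p w - fst (snd p) * frame_form fst 0 3 p w,
     frame_form fst 3 4 p w - (fst (snd p) * frame_form fst 0 2 p w + fst (snd (snd p)) * frame_form fst 0 3 p w),
     frame_form fst 1 2 p w - fst (snd (snd (snd p))) * frame_form fst 0 3 p w,
     frame_form fst 1 3 p w,
     frame_form fst 1 0 p w - fst (snd (snd (snd (snd p)))) * frame_form fst 0 3 p w,
     frame_form fst 2 3 p w - snd (snd (snd (snd (snd p)))) * frame_form fst 0 3 p w)"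
  by (cases p) (simp add: cone_system_def)

lemma linear_frame_form_fst: "linear (frame_form fst u v p)"
  unfolding frame_form_fst
  by (rule linearI) (simp_all add: matrix_matrix_mult_def distrib_right sum.distrib sum_distrib_left mult.assoc)

text \<open>The form \<open>\<kappa>\<close> of \<open>cone_coframe\<close> satisfies d\<omega>_0^3
  = \<kappa> \<and> \<omega>_0^3 modulo the system; its \<omega>_0^2 term comes from \<omega>_2^3 =
  b \<omega>_0^3. In the equation for \<omega>_3^4 the factor of \<omega>_0^2 agrees with \<alpha>_1
  up to a multiple of \<omega>_0^2, which the wedge product kills.\<close>

lemma ext_d_cone_system:
  fixes u v :: cone_point
  assumes p: "p \<in> cone_domain"
    and u: "u \<in> integral_vectors cone_system p" and v: "v \<in> integral_vectors cone_system p"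
  shows "ext_d cone_system p u v = cone_quadratic (cone_coframe p u) (cone_coframe p v)"
proof -
  obtain A b23 b33 c a b where p_eq: "p = (A, b23, b33, c, a, b)" by (cases p)
  obtain U db23 db33 dc da db where u_eq: "u = (U, db23, db33, dc, da, db)" by (cases u)
  obtain V db23' db33' dc' da' db' where v_eq: "v = (V, db23', db33', dc', da', db')" by (cases v)
  have inv: "invertible (fst p)" using p unfolding cone_domain_def p_eq by simp
  note dF = has_derivative_frame_form_fst[OF inv]
  have bl: "bounded_linear (\<lambda>q :: cone_point. fst (snd q))" "bounded_linear (\<lambda>q :: cone_point. fst (snd (snd q)))"
    "bounded_linear (\<lambda>q :: cone_point. fst (snd (snd (snd q))))"
    "bounded_linear (\<lambda>q :: cone_point. fst (snd (snd (snd (snd q)))))"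
    "bounded_linear (\<lambda>q :: cone_point. snd (snd (snd (snd (snd q)))))"
    by (intro bounded_linear_fst_comp bounded_linear_snd_comp bounded_linear_ident)+
  note dc = bl[THEN bounded_linear_imp_has_derivative]
  let ?d = "\<lambda>i j w z. - (\<Sum>k\<in>UNIV. frame_form fst i k p w * frame_form fst k j p z)"
  have d: "frechet_derivative (\<lambda>q. cone_system q w) (at p) z =
    (?d 0 4 w z, ?d 1 4 w z,
     ?d 2 4 w z - (fst (snd p) * ?d 0 3 w z + fst (snd z) * frame_form fst 0 3 p w),
     ?d 3 4 w z - ((fst (snd p) * ?d 0 2 w z + fst (snd z) * frame_form fst 0 2 p w)
       + (fst (snd (snd p)) * ?d 0 3 w z + fst (snd (snd z)) * frame_form fst 0 3 p w)),
     ?d 1 2 w z - (fst (snd (snd (snd p))) * ?d 0 3 w z + fst (snd (snd (snd z))) * frame_form fst 0 3 p w),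
     ?d 1 3 w z,
     ?d 1 0 w z - (fst (snd (snd (snd (snd p)))) * ?d 0 3 w z + fst (snd (snd (snd (snd z)))) * frame_form fst 0 3 p w),
     ?d 2 3 w z - (snd (snd (snd (snd (snd p)))) * ?d 0 3 w z + snd (snd (snd (snd (snd z)))) * frame_form fst 0 3 p w))"
    for w z
    unfolding cone_system_eq
    by (rule fun_cong[OF frechet_derivative_at[symmetric]])
      (intro has_derivative_Pair has_derivative_diff has_derivative_add has_derivative_mult dF dc)
  have eqs: "frame_form fst 0 4 p w = 0" "frame_form fst 1 4 p w = 0"
     "frame_form fst 2 4 p w = b23 * frame_form fst 0 3 p w"
     "frame_form fst 3 4 p w = b23 * frame_form fst 0 2 p w + b33 * frame_form fst 0 3 p w"
     "frame_form fst 1 2 p w = c * frame_form fst 0 3 p w"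
     "frame_form fst 1 3 p w = 0"
     "frame_form fst 1 0 p w = a * frame_form fst 0 3 p w"
     "frame_form fst 2 3 p w = b * frame_form fst 0 3 p w"
    if "w \<in> integral_vectors cone_system p" for w
    using that unfolding integral_vectors_def cone_system_eq by (simp_all add: p_eq zero_prod_def)
  show ?thesis
    unfolding ext_d_def d cone_quadratic_def cone_coframe_def Let_def sum_5 eqs[OF u] eqs[OF v]
    unfolding p_eq u_eq v_eq
    by (simp add: eqs[OF u, unfolded p_eq u_eq] eqs[OF v, unfolded p_eq v_eq] algebra_simps)
qed

lemma linear_Pair: "linear f \<Longrightarrow> linear g \<Longrightarrow> linear (\<lambda>x. (f x, g x))"
  by (rule linearI) (simp_all add: linear_add linear_scale)

lemma linear_mult_left: "linear f \<Longrightarrow> linear (\<lambda>x. (r :: real) * f x)"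
  using linear_compose_scale_right[of f r] by simp

lemma subspace_linear_preimage:
  assumes "linear f" "subspace V" "subspace T"
  shows "subspace {w \<in> V. f w \<in> T}"
  using assms(2,3)
  by (auto simp: subspace_def linear_0[OF assms(1)] linear_add[OF assms(1)] linear_scale[OF assms(1)])

lemma linear_cone_coframe: "linear (cone_coframe p)"
proof -
  obtain A b23 b33 c a b where p_eq: "p = (A, b23, b33, c, a, b)" by (cases p)
  note lin = linear_frame_form_fst[of _ _ p, unfolded p_eq]
  have pr: "linear (\<lambda>q :: cone_point. fst (snd q))" "linear (\<lambda>q :: cone_point. fst (snd (snd q)))"
    "linear (\<lambda>q :: cone_point. fst (snd (snd (snd q))))"
    "linear (\<lambda>q :: cone_point. fst (snd (snd (snd (snd q)))))"
    "linear (\<lambda>q :: cone_point. snd (snd (snd (snd (snd q)))))"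
    by (rule linearI; simp)+
  show ?thesis
    unfolding p_eq cone_coframe_def Let_def case_prod_beta split fst_conv snd_conv
    by (intro linear_Pair linear_compose_add linear_compose_sub linear_compose_neg linear_mult_left lin pr)
qed

lemma subspace_integral_vectors: "subspace (integral_vectors cone_system p)"
proof -
  have "linear (cone_system p)"
    unfolding cone_system_eq[abs_def]
    by (intro linear_Pair linear_compose_add linear_compose_sub linear_mult_left linear_frame_form_fst)
  then show ?thesis unfolding integral_vectors_def by (rule linear_subspace_kernel)
qed

lemma cone_coframe_surj:
  assumes "p \<in> cone_domain"
  shows "\<exists>w \<in> integral_vectors cone_system p. cone_coframe p w = t"
proof -
  obtain A b23 b33 c a b where p: "p = (A, b23, b33, c, a, b)" by (cases p)
  obtain y2 y3 z1 z2 z3 z4 z5 where t: "t = (y2, y3, z1, z2, z3, z4, z5)" by (cases t)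
  have inv: "invertible A" using assms unfolding p cone_domain_def by simp
  \<comment> \<open>Only the forms dictated by \<open>y2\<close>, \<open>y3\<close> and the system
    are nonzero. Then \<open>\<kappa>\<close> equals \<open>b * y2\<close>, and each \<alpha>_i is
    solved for the differential of its own unknown function.\<close>
  define M :: "real^5^5" where "M = (\<chi> i. if i = 0 then vec5 0 0 y2 y3 0
     else if i = 1 then vec5 (a * y3) 0 (c * y3) 0 0
     else if i = 2 then vec5 0 0 0 (b * y3) (b23 * y3)
     else if i = 3 then vec5 0 0 0 0 (b23 * y2 + b33 * y3) else 0)"
  have M: "M $ 0 = vec5 0 0 y2 y3 0" "M $ 1 = vec5 (a * y3) 0 (c * y3) 0 0"
    "M $ 2 = vec5 0 0 0 (b * y3) (b23 * y3)" "M $ 3 = vec5 0 0 0 0 (b23 * y2 + b33 * y3)" "M $ 4 = 0"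
    by (simp_all add: M_def)
  define w :: cone_point where "w = (M ** A, - b * b23 * y2 - b23 * (b * y2) - z1, - b33 * (b * y2) - z2,
     - a * y2 - c * (b * y2) - z3, - a * (b * y2) - z4, - b * (b * y2) - z5)"
  have \<omega>: "frame_form fst i j p w = M $ i $ j" for i j
    unfolding frame_form_fst p w_def by (simp add: matrix_inv_mult(1)[OF inv] flip: matrix_mul_assoc)
  have "w \<in> integral_vectors cone_system p"
    unfolding integral_vectors_def cone_system_eq mem_Collect_eq \<omega> by (simp add: p M zero_prod_def)
  moreover have "cone_coframe p w = t"
    unfolding cone_coframe_def Let_def case_prod_beta fst_conv snd_conv \<omega> by (simp add: p w_def M t)
  ultimately show ?thesis by blast
qed

section \<open>Cartan characters and integral elements\<close>

lemma cone_basis_eq: "cone_basis p w = (fst (cone_coframe p w), fst (snd (cone_coframe p w)))"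
  by (cases p; cases w) (simp add: cone_basis_def cone_coframe_def Let_def)

lemma cone_quadratic_0: "cone_quadratic x 0 = 0"
  by (cases x) (simp add: cone_quadratic_def zero_prod_def)

text \<open>Tested against a vector dual to \<omega>_0^3, the quadratic equations become
  -\<alpha>_1, ..., -\<alpha>_5, so this one vector already forces the whole coframe to
  vanish.\<close>

lemma characteristic_vectors_cone_system:
  assumes p: "p \<in> cone_domain"
  shows "characteristic_vectors cone_system cone_basis p = {w \<in> integral_vectors cone_system p. cone_coframe p w = 0}"
    (is "?C = ?K")
proof
  show "?K \<subseteq> ?C"
  proof
    fix w assume w: "w \<in> ?K"
    then have "ext_d cone_system p v w = 0" if "v \<in> integral_vectors cone_system p" for v
      using ext_d_cone_system[OF p that, of w] by (simp add: cone_quadratic_0)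
    moreover have "cone_basis p w = 0" using w by (simp add: cone_basis_eq prod_eq_iff)
    ultimately show "w \<in> ?C" using w unfolding characteristic_vectors_def by blast
  qed
  show "?C \<subseteq> ?K"
  proof
    fix w assume w: "w \<in> ?C"
    obtain v where v: "v \<in> integral_vectors cone_system p" "cone_coframe p v = (0, 1, 0, 0, 0, 0, 0)"
      using cone_coframe_surj[OF p] by blast
    have "w \<in> integral_vectors cone_system p" "cone_basis p w = 0" "ext_d cone_system p v w = 0"
      using w v(1) unfolding characteristic_vectors_def by auto
    moreover from this have "cone_quadratic (0, 1, 0, 0, 0, 0, 0) (cone_coframe p w) = 0"
      using ext_d_cone_system[OF p v(1), of w] v(2) by simp
    ultimately show "w \<in> ?K"
      by (cases "cone_coframe p w") (simp add: cone_basis_eq cone_quadratic_def zero_prod_def)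
  qed
qed

lemma dim_range_linear_inj:
  fixes h :: "'a::euclidean_space \<Rightarrow> 'b::euclidean_space"
  assumes "linear h" "\<And>x. h x = 0 \<Longrightarrow> x = 0"
  shows "dim (range h) = DIM('a)"
  using dim_image_eq[OF assms(1), of UNIV] assms by (simp add: linear_injective_0 inj_on_subset dim_UNIV)

text \<open>A common bound for the values of the exterior derivative. The values of all pairs fill
  it, and so does a single polar map; hence the number of equations and the first character
  coincide.\<close>

definition quadratic_values :: "(real \<times> real \<times> real \<times> real \<times> real \<times> real \<times> real \<times> real) set" where
  "quadratic_values = range (\<lambda>(r, s, t, u, v). (0, 0, r, s, t, 0, u, v))"

lemma dim_quadratic_values: "dim quadratic_values = 5"
proof -
  have "linear (\<lambda>(r, s, t, u, v). (0, 0, r, s, t, 0, u, v) :: real \<times> real \<times> real \<times> real \<times> real \<times> real \<times> real \<times> real)"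
    by (rule linearI) auto
  from dim_range_linear_inj[OF this] show ?thesis
    unfolding quadratic_values_def by (auto simp: zero_prod_def)
qed

lemma cone_quadratic_in_values: "cone_quadratic x y \<in> quadratic_values"
  unfolding quadratic_values_def cone_quadratic_def
  by (cases x; cases y) (auto intro!: range_eqI[of _ _ "(_, _, _, _, _)"])

lemma ext_d_in_quadratic_values:
  assumes "p \<in> cone_domain" "u \<in> integral_vectors cone_system p" "v \<in> integral_vectors cone_system p"
  shows "ext_d cone_system p u v \<in> quadratic_values"
  unfolding ext_d_cone_system[OF assms] by (rule cone_quadratic_in_values)

text \<open>The preimage has both basis components zero, as the polar equations in
  \<open>first_character\<close> demand.\<close>

lemma quadratic_values_cases:
  assumes "z \<in> quadratic_values"
  obtains x where "fst x = 0" "fst (snd x) = 0" "cone_quadratic (0, 1, 0, 0, 0, 0, 0) x = z"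
proof -
  obtain r s t u v where "z = (0, 0, r, s, t, 0, u, v)" using assms unfolding quadratic_values_def by auto
  then show ?thesis by (intro that[of "(0, 0, - r, - s, - t, - u, - v)"]) (simp_all add: cone_quadratic_def)
qed

lemma quadratic_equations_cone_system:
  assumes p: "p \<in> cone_domain"
  shows "quadratic_equations cone_system p = 5"
proof -
  let ?V = "integral_vectors cone_system p"
  have "{ext_d cone_system p u v | u v. u \<in> ?V \<and> v \<in> ?V} = quadratic_values"
  proof (intro set_eqI iffI)
    fix z assume "z \<in> {ext_d cone_system p u v | u v. u \<in> ?V \<and> v \<in> ?V}"
    then show "z \<in> quadratic_values" using ext_d_in_quadratic_values[OF p] by blast
  next
    fix z assume "z \<in> quadratic_values"
    then obtain x where x: "cone_quadratic (0, 1, 0, 0, 0, 0, 0) x = z" by (rule quadratic_values_cases)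
    obtain u v where uv: "u \<in> ?V" "cone_coframe p u = (0, 1, 0, 0, 0, 0, 0)" "v \<in> ?V" "cone_coframe p v = x"
      using cone_coframe_surj[OF p] by metis
    then have "z = ext_d cone_system p u v" using ext_d_cone_system[OF p, of u v] x by simp
    then show "z \<in> {ext_d cone_system p u v | u v. u \<in> ?V \<and> v \<in> ?V}" using uv by blast
  qed
  then show ?thesis unfolding quadratic_equations_def by (simp add: dim_quadratic_values)
qed

lemma first_character_cone_system:
  assumes p: "p \<in> cone_domain"
  shows "first_character cone_system cone_basis p = 5"
  unfolding first_character_def
proof (rule Max_eqI)
  let ?V = "integral_vectors cone_system p" and ?W = "{w \<in> integral_vectors cone_system p. cone_basis p w = 0}"
  let ?r = "\<lambda>v. dim (ext_d cone_system p v ` ?W)"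
  have sub: "ext_d cone_system p v ` ?W \<subseteq> quadratic_values" if "v \<in> ?V" for v
    using ext_d_in_quadratic_values[OF p that] by blast
  then have le: "?r v \<le> 5" if "v \<in> ?V" for v
    using dim_subset[OF sub[OF that]] by (simp add: dim_quadratic_values)
  \<comment> \<open>\<open>Max\<close> is informative only on a finite set; the ranks form one
    because 5 bounds them.\<close>
  then have "?r ` ?V \<subseteq> {..5}" by auto
  then show "finite (?r ` ?V)" by (rule finite_subset) simp
  show "y \<le> 5" if "y \<in> ?r ` ?V" for y using that le by auto
  obtain v where v: "v \<in> ?V" "cone_coframe p v = (0, 1, 0, 0, 0, 0, 0)" using cone_coframe_surj[OF p] by blast
  have "quadratic_values \<subseteq> ext_d cone_system p v ` ?W"
  proof
    fix z assume "z \<in> quadratic_values"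
    then obtain x where x: "fst x = 0" "fst (snd x) = 0" "cone_quadratic (0, 1, 0, 0, 0, 0, 0) x = z"
      by (rule quadratic_values_cases)
    obtain w where w: "w \<in> ?V" "cone_coframe p w = x" using cone_coframe_surj[OF p] by metis
    then have "w \<in> ?W" using x by (simp add: cone_basis_eq zero_prod_def)
    moreover have "z = ext_d cone_system p v w" using ext_d_cone_system[OF p v(1) w(1)] v(2) w(2) x(3) by simp
    ultimately show "z \<in> ext_d cone_system p v ` ?W" by blast
  qed
  then have "ext_d cone_system p v ` ?W = quadratic_values" using sub[OF v(1)] by blast
  then show "5 \<in> ?r ` ?V" using v(1) by (intro image_eqI[of _ _ v]) (simp_all add: dim_quadratic_values)
qed

lemma occurring_forms_cone_system:
  assumes p: "p \<in> cone_domain"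
  shows "occurring_forms cone_system cone_basis p = 5"
proof -
  let ?V = "integral_vectors cone_system p"
  have "UNIV \<subseteq> cone_coframe p ` ?V" using cone_coframe_surj[OF p] by (metis imageI subsetI)
  from dim_linear_preimage[OF linear_cone_coframe subspace_integral_vectors subspace_UNIV this]
  \<comment> \<open>The coframe has seven components, and two of them are the basis forms.\<close>
  have "dim ?V = dim {w \<in> ?V. cone_coframe p w = 0} + 7" by (simp add: dim_UNIV)
  then show ?thesis
    unfolding occurring_forms_def characteristic_vectors_cone_system[OF p] by simp
qed

lemma integral_elements_cone_system:
  assumes p: "p \<in> cone_domain"
  shows "affine (integral_elements cone_system cone_basis p)"
    and "integral_elements_dim cone_system cone_basis p = 5"
proof -
  let ?V = "integral_vectors cone_system p" and ?E = "integral_elements cone_system cone_basis p"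
  define P where "P = (\<lambda>(u, v). (cone_coframe p u, cone_coframe p v))"
  \<comment> \<open>Cartan's lemma: \<alpha>_1 = r \<omega>_0^3, \<alpha>_2 = r \<omega>_0^2 + s
    \<omega>_0^3, while \<alpha>_3, \<alpha>_4, \<alpha>_5 are the multiples \<open>t\<close>,
    \<open>y\<close>, \<open>z\<close> of \<omega>_0^3. The shared \<open>r\<close> reflects the
    double occurrence of \<alpha>_1.\<close>
  define T where "T = range (\<lambda>(r, s, t, y, z). ((0, 0, 0, r, 0, 0, 0), (0, 0, r, s, t, y, z)) :: real7 \<times> real7)"
  have linP: "linear P"
    unfolding P_def case_prod_beta
    using linear_compose[OF linear_fst linear_cone_coframe] linear_compose[OF linear_snd linear_cone_coframe]
    unfolding comp_def by (rule linear_Pair)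
  have linT: "linear (\<lambda>(r, s, t, y, z). ((0, 0, 0, r, 0, 0, 0), (0, 0, r, s, t, y, z)) :: real7 \<times> real7)"
    by (rule linearI) auto
  have subT: "subspace T" unfolding T_def by (rule linear_subspace_image[OF linT subspace_UNIV])
  have dimT: "dim T = 5"
    using dim_range_linear_inj[OF linT] unfolding T_def by (auto simp: zero_prod_def)
  have VV: "subspace (?V \<times> ?V)" by (intro subspace_Times subspace_integral_vectors)
  have surj: "T \<subseteq> P ` (?V \<times> ?V)"
  proof
    fix t assume "t \<in> T"
    obtain u v where "u \<in> ?V" "cone_coframe p u = fst t" "v \<in> ?V" "cone_coframe p v = snd t"
      using cone_coframe_surj[OF p] by metis
    then show "t \<in> P ` (?V \<times> ?V)" unfolding P_def by (intro image_eqI[of _ _ "(u, v)"]) simp_all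
  qed
  define S where "S = {e \<in> ?V \<times> ?V. P e \<in> T}"
  have subS: "subspace S"
    unfolding S_def by (rule subspace_linear_preimage[OF linP VV subT])
  let ?K = "characteristic_vectors cone_system cone_basis p"
  have K: "?K = {w \<in> ?V. cone_coframe p w = 0}" by (rule characteristic_vectors_cone_system[OF p])
  have subK: "subspace ?K"
    using subspace_linear_preimage[OF linear_cone_coframe[of p] subspace_integral_vectors[of p] subspace_single_0]
    unfolding K by simp
  have "{e \<in> ?V \<times> ?V. P e = 0} = ?K \<times> ?K" unfolding K P_def by (auto simp: zero_prod_def)
  \<comment> \<open>Either basis vector may be changed by a characteristic vector;
    \<open>integral_elements_dim\<close> subtracts exactly this surplus.\<close>
  then have dimS: "dim S = 2 * dim ?K + 5"
    using dim_linear_preimage[OF linP VV subT surj] dim_Times[OF subK subK] unfolding S_def dimT by simp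
  \<comment> \<open>An origin of the affine space: an integral element on which all \<alpha>_i
    vanish.\<close>
  obtain u0 where u0: "u0 \<in> ?V" "cone_coframe p u0 = (1, 0, 0, 0, 0, 0, 0)" using cone_coframe_surj[OF p] by blast
  obtain v0 where v0: "v0 \<in> ?V" "cone_coframe p v0 = (0, 1, 0, 0, 0, 0, 0)" using cone_coframe_surj[OF p] by blast
  have mem: "(u, v) \<in> ?E \<longleftrightarrow> (u - u0, v - v0) \<in> S" for u v
  proof -
    have iff: "u \<in> ?V \<longleftrightarrow> u - u0 \<in> ?V" "v \<in> ?V \<longleftrightarrow> v - v0 \<in> ?V"
      using subspace_add[OF subspace_integral_vectors, of _ p] subspace_diff[OF subspace_integral_vectors, of _ p] u0(1) v0(1)
      by (metis diff_add_cancel)+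
    obtain x2 x3 x4 x5 x6 x7 x8 where x: "cone_coframe p u = (x2, x3, x4, x5, x6, x7, x8)"
      by (cases "cone_coframe p u")
    obtain y2 y3 y4 y5 y6 y7 y8 where y: "cone_coframe p v = (y2, y3, y4, y5, y6, y7, y8)"
      by (cases "cone_coframe p v")
    have "(u - u0, v - v0) \<in> S \<longleftrightarrow> u \<in> ?V \<and> v \<in> ?V \<and> (x2, x3) = (1, 0) \<and> (y2, y3) = (0, 1) \<and>
        x4 = 0 \<and> x5 = y4 \<and> x6 = 0 \<and> x7 = 0 \<and> x8 = 0"
      unfolding S_def P_def T_def by (auto simp: image_iff iff linear_diff[OF linear_cone_coframe] u0 v0 x y)
    moreover have "(u, v) \<in> ?E \<longleftrightarrow> u \<in> ?V \<and> v \<in> ?V \<and> (x2, x3) = (1, 0) \<and> (y2, y3) = (0, 1) \<and>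
        x4 = 0 \<and> x5 = y4 \<and> x6 = 0 \<and> x7 = 0 \<and> x8 = 0"
      unfolding integral_elements_def
      by (auto simp: cone_basis_eq ext_d_cone_system[OF p] x y cone_quadratic_def zero_prod_def)
    ultimately show ?thesis by blast
  qed
  have E: "?E = (+) (u0, v0) ` S"
  proof (intro set_eqI iffI)
    fix e assume "e \<in> ?E"
    then have "(fst e - u0, snd e - v0) \<in> S" using mem[of "fst e" "snd e"] by simp
    then show "e \<in> (+) (u0, v0) ` S" by (intro image_eqI[of _ _ "(fst e - u0, snd e - v0)"]) (simp_all add: prod_eq_iff)
  next
    fix e assume "e \<in> (+) (u0, v0) ` S"
    then obtain s where s: "s \<in> S" "e = (u0, v0) + s" by blast
    then have "e = (u0 + fst s, v0 + snd s)" by (simp add: prod_eq_iff)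
    then show "e \<in> ?E" using mem[of "u0 + fst s" "v0 + snd s"] s(1) by simp
  qed
  show "affine ?E" unfolding E using subspace_imp_affine[OF subS] affine_translation by blast
  have "aff_dim ?E = int (dim S)" unfolding E aff_dim_translation_eq by (rule aff_dim_subspace[OF subS])
  then show "integral_elements_dim cone_system cone_basis p = 5"
    unfolding integral_elements_dim_def dimS by simp
qed

lemma general_solution_cone_system: "general_solution_depends_on cone_system cone_basis cone_domain 5 1"
  unfolding general_solution_depends_on_def in_involution_def cartan_character_def
  by (simp add: integral_elements_cone_system first_character_cone_system occurring_forms_cone_system)

theorem theorem2:
  shows "(\<forall>(f :: real^3 \<Rightarrow> real^5) U A.
            hypersurface f U \<and> has_gauss_rank f U 2 \<and> adapted_frame f U A \<and>
            (\<forall>x\<in>U. \<forall>u v. wedge (frame_form A 1 0 x) (frame_form A 0 3 x) u v = 0)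
            \<longrightarrow> describes_curve (\<lambda>x. A x $ 1) U \<and> twisted_cone f U)
       \<and> (\<exists>(f :: real^3 \<Rightarrow> real^5) U \<Phi>. twisted_cone f U \<and>
            solves_system cone_system cone_basis cone_domain \<Phi> U \<and>
            (\<forall>x\<in>U. span {fst (\<Phi> x) $ 0} = span {f x}))
       \<and> (\<forall>p\<in>cone_domain. first_character cone_system cone_basis p = quadratic_equations cone_system p)
       \<and> general_solution_depends_on cone_system cone_basis cone_domain 5 1"
proof (intro conjI)
  show "\<forall>(f :: real^3 \<Rightarrow> real^5) U A.
            hypersurface f U \<and> has_gauss_rank f U 2 \<and> adapted_frame f U A \<and>
            (\<forall>x\<in>U. \<forall>u v. wedge (frame_form A 1 0 x) (frame_form A 0 3 x) u v = 0)
            \<longrightarrow> describes_curve (\<lambda>x. A x $ 1) U \<and> twisted_cone f U"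
  proof (intro allI impI)
    fix f :: "real^3 \<Rightarrow> real^5" and U A
    assume *: "hypersurface f U \<and> has_gauss_rank f U 2 \<and> adapted_frame f U A \<and>
            (\<forall>x\<in>U. \<forall>u v. wedge (frame_form A 1 0 x) (frame_form A 0 3 x) u v = 0)"
    then interpret adapted_hypersurface f U A by unfold_locales auto
    show "describes_curve (\<lambda>x. A x $ 1) U \<and> twisted_cone f U"
      using * twisted_cone_if_focal_curve by blast
  qed
  show "\<exists>(f :: real^3 \<Rightarrow> real^5) U \<Phi>. twisted_cone f U \<and>
            solves_system cone_system cone_basis cone_domain \<Phi> U \<and>
            (\<forall>x\<in>U. span {fst (\<Phi> x) $ 0} = span {f x})"
  proof (intro exI conjI ballI)
    show "twisted_cone cone_point_map UNIV" by (rule twisted_cone_cone_point_map)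
    show "solves_system cone_system cone_basis cone_domain cone_solution UNIV" by (rule solves_system_cone_solution)
    show "span {fst (cone_solution x) $ 0} = span {cone_point_map x}" for x
      by (simp add: cone_solution_def cone_point_map_def)
  qed
  show "\<forall>p\<in>cone_domain. first_character cone_system cone_basis p = quadratic_equations cone_system p"
    by (simp add: first_character_cone_system quadratic_equations_cone_system)
  show "general_solution_depends_on cone_system cone_basis cone_domain 5 1"
    by (rule general_solution_cone_system)
qed

end
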